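(* Let $T$ be a tree with $t$ vertices that is neither a star nor a double star. Then $$\mathrm{ex}(n,T,\textup{rainbow-}T)=\Omega\big(n^{\lceil t/4\rceil}\big)$$ as $n\to\infty$, with the implied constant depending only on $T$.
   Context: A star is a tree in which one vertex is adjacent to all the other vertices. A double star is a tree whose longest path has exactly four vertices, equivalently a tree with an edge $uv$ such that every vertex is adjacent to $u$ or $v$. An edge-coloring of a graph is proper if any two edges sharing a vertex receive different colors. A subgraph of an edge-colored graph is rainbow if all its edges have distinct colors. For graphs $H$ and $F$, $\mathrm{ex}(n,H,\textup{rainbow-}F)$ denotes the maximum number of copies of $H$ (subgraphs isomorphic to $H$) in a graph $G$ on $n$ vertices equipped with a proper edge-coloring in which there is no rainbow copy of $F$. *)

theory Defs
  imports Complex_Main "HOL-Library.Landau_Symbols"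
begin

text \<open>
  The trees of the AFP entry \<open>Graph_Theory\<close> are orientations of undirected trees
  (there, a pair of opposite arcs already forms a cycle), so they do not describe trees
  among simple graphs.  Simple graphs are therefore represented by a vertex set and a
  set of two-element edges.
\<close>

datatype 'a ugraph = UGraph (uverts: "'a set") (uedges: "'a set set")

definition simple_graph :: "'a ugraph \<Rightarrow> bool" where
  "simple_graph G \<longleftrightarrow> finite (uverts G) \<and> (\<forall>e\<in>uedges G. e \<subseteq> uverts G \<and> card e = 2)"

definition adjacent :: "'a ugraph \<Rightarrow> 'a \<Rightarrow> 'a \<Rightarrow> bool" where
  "adjacent G u v \<longleftrightarrow> {u, v} \<in> uedges G"

text \<open>Paths are lists of vertices; the length of the list is the number of vertices.\<close>

definition graph_path :: "'a ugraph \<Rightarrow> 'a list \<Rightarrow> bool" where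
  "graph_path G p \<longleftrightarrow>
     p \<noteq> [] \<and> set p \<subseteq> uverts G \<and> distinct p \<and> successively (adjacent G) p"

definition graph_cycle :: "'a ugraph \<Rightarrow> 'a list \<Rightarrow> bool" where
  "graph_cycle G p \<longleftrightarrow> graph_path G p \<and> length p \<ge> 3 \<and> adjacent G (last p) (hd p)"

definition connected_graph :: "'a ugraph \<Rightarrow> bool" where
  "connected_graph G \<longleftrightarrow> uverts G \<noteq> {} \<and>
     (\<forall>u\<in>uverts G. \<forall>v\<in>uverts G. \<exists>p. graph_path G p \<and> hd p = u \<and> last p = v)"

definition is_tree :: "'a ugraph \<Rightarrow> bool" where
  "is_tree G \<longleftrightarrow> simple_graph G \<and> connected_graph G \<and> (\<nexists>p. graph_cycle G p)"

definition is_star :: "'a ugraph \<Rightarrow> bool" where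
  "is_star G \<longleftrightarrow> is_tree G \<and> (\<exists>c\<in>uverts G. \<forall>v\<in>uverts G - {c}. adjacent G c v)"

definition is_double_star :: "'a ugraph \<Rightarrow> bool" where
  "is_double_star G \<longleftrightarrow> is_tree G \<and>
     (\<exists>p. graph_path G p \<and> length p = 4) \<and> (\<forall>p. graph_path G p \<longrightarrow> length p \<le> 4)"

definition isomorphic_graphs :: "'a ugraph \<Rightarrow> 'b ugraph \<Rightarrow> bool" where
  "isomorphic_graphs G H \<longleftrightarrow>
     (\<exists>f. bij_betw f (uverts G) (uverts H) \<and> (\<lambda>e. f ` e) ` uedges G = uedges H)"

definition is_subgraph :: "'a ugraph \<Rightarrow> 'a ugraph \<Rightarrow> bool" where
  "is_subgraph H G \<longleftrightarrow>
     simple_graph H \<and> uverts H \<subseteq> uverts G \<and> uedges H \<subseteq> uedges G"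

text \<open>Copies are (unlabelled, not necessarily induced) subgraphs, not embeddings.\<close>

definition copies :: "'a ugraph \<Rightarrow> 'b ugraph \<Rightarrow> 'b ugraph set" where
  "copies H G = {K. is_subgraph K G \<and> isomorphic_graphs H K}"

definition proper_edge_coloring :: "'a ugraph \<Rightarrow> ('a set \<Rightarrow> 'c) \<Rightarrow> bool" where
  "proper_edge_coloring G c \<longleftrightarrow>
     (\<forall>e\<in>uedges G. \<forall>f\<in>uedges G. e \<noteq> f \<and> e \<inter> f \<noteq> {} \<longrightarrow> c e \<noteq> c f)"

definition rainbow :: "('a set \<Rightarrow> 'c) \<Rightarrow> 'a ugraph \<Rightarrow> bool" where
  "rainbow c K \<longleftrightarrow> inj_on c (uedges K)"

text \<open>
  Taking vertices and colors in \<^typ>\<open>nat\<close> loses no generality, as all graphs are finite.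
\<close>

definition rainbow_ex_counts :: "nat \<Rightarrow> 'a ugraph \<Rightarrow> 'b ugraph \<Rightarrow> nat set" where
  "rainbow_ex_counts n H F =
     {card (copies H G) | (G :: nat ugraph) (c :: nat set \<Rightarrow> nat).
        simple_graph G \<and> card (uverts G) = n \<and> proper_edge_coloring G c \<and>
        (\<nexists>K. K \<in> copies F G \<and> rainbow c K)}"

definition rainbow_ex :: "nat \<Rightarrow> 'a ugraph \<Rightarrow> 'b ugraph \<Rightarrow> nat" where
  "rainbow_ex n H F = Max (rainbow_ex_counts n H F)"

text \<open>
  The maximum in \<^const>\<open>rainbow_ex\<close> is over a finite set, which is nonempty as soon as
  the forbidden graph has an edge.
\<close>

lemma finite_rainbow_ex_counts: "finite (rainbow_ex_counts n H F)"
proof -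
  have "card (copies H G) \<le> 2 ^ n * 2 ^ 2 ^ n"
    if "simple_graph G" "card (uverts G) = n" for G :: "nat ugraph"
  proof -
    let ?S = "Pow (uverts G) \<times> Pow (Pow (uverts G))"
    have fin: "finite (uverts G)" and sub: "uedges G \<subseteq> Pow (uverts G)"
      using that by (auto simp: simple_graph_def)
    have "copies H G \<subseteq> (\<lambda>(V, E). UGraph V E) ` ?S"
    proof
      fix K assume "K \<in> copies H G"
      then have "(uverts K, uedges K) \<in> ?S"
        using sub by (auto simp: copies_def is_subgraph_def)
      then show "K \<in> (\<lambda>(V, E). UGraph V E) ` ?S"
        by (intro image_eqI[of _ _ "(uverts K, uedges K)"]) auto
    qed
    then have "card (copies H G) \<le> card ?S"
      using fin by (meson card_image_le card_mono finite_Pow_iff finite_SigmaI finite_imageI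
          order_trans)
    also have "\<dots> = 2 ^ n * 2 ^ 2 ^ n"
      using fin that by (simp add: card_cartesian_product card_Pow)
    finally show ?thesis .
  qed
  then have "rainbow_ex_counts n H F \<subseteq> {..2 ^ n * 2 ^ 2 ^ n}"
    by (auto simp: rainbow_ex_counts_def)
  then show ?thesis
    by (rule finite_subset) simp
qed

lemma rainbow_ex_counts_nonempty:
  assumes "uedges F \<noteq> {}"
  shows "rainbow_ex_counts n H F \<noteq> {}"
proof -
  let ?G = "UGraph {..<n} {}"
  have "copies F ?G = {}"
    using assms by (auto simp: copies_def is_subgraph_def isomorphic_graphs_def)
  then have "card (copies H ?G) \<in> rainbow_ex_counts n H F"
    unfolding rainbow_ex_counts_def
    by (intro CollectI exI[of _ ?G])
       (simp add: simple_graph_def proper_edge_coloring_def)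
  then show ?thesis by blast
qed

end

theory Submission
  imports Defs "HOL-Library.FuncSet"
begin

text \<open>
  Replace every vertex of a set \<open>W \<subseteq> V(T)\<close> by \<open>N\<close> copies, keeping copies of adjacent vertices
  of \<open>W\<close> matched index by index.  This graph has at most \<open>t N\<close> vertices and at least \<open>N\<^sup>k\<close>
  copies of \<open>T\<close>, where \<open>k\<close> is the number of components of \<open>T[W]\<close>.  Give one color to a
  matching \<open>Z\<close> and pairwise different colors to all other edges; if every copy of \<open>T\<close> uses two
  edges of \<open>Z\<close>, there is no rainbow copy.  Let \<open>L\<close> be the number of leaves of \<open>T\<close>.

  If \<open>L + 1 + 2 \<lfloor>t/3\<rfloor> \<le> t\<close>, take a set \<open>U\<close> of at most \<open>t/3\<close> vertices whose deletion leaves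
  components of size at most 2, let \<open>W\<close> be its complement and \<open>Z\<close> all edges inside the copies
  of \<open>W\<close>.  A copy of \<open>T\<close> meets \<open>U\<close> in at most \<open>t/3\<close> vertices, which cover all but at least
  two of its edges, since few leaves force the degrees to exceed 2 only slightly in total.

  Otherwise \<open>L \<ge> t/3\<close>, and \<open>W\<close> consists of leaves.  Every copy of \<open>T\<close> contains all edges
  between non-leaves of \<open>T\<close>.  If two of these are disjoint, blow up all leaves and let \<open>Z\<close>
  consist of these two edges.  If not, the non-leaves form a star, which has at least two edges as
  \<open>T\<close> is neither a star nor a double star; then \<open>Z\<close> consists of an edge of this star and a leaf
  edge at one of its other end vertices.
\<close>

subsection \<open>Embeddings and the lower bound from a monochromatic matching\<close>

definition nbrs :: "'a ugraph \<Rightarrow> 'a \<Rightarrow> 'a set" where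
  "nbrs G v = {u. {v, u} \<in> uedges G}"

text \<open>The edge condition already places every non-isolated vertex of \<open>H\<close> inside a
  simple graph \<open>G\<close>.\<close>

definition embedding :: "'a ugraph \<Rightarrow> 'b ugraph \<Rightarrow> ('a \<Rightarrow> 'b) \<Rightarrow> bool" where
  "embedding H G f \<longleftrightarrow> inj_on f (uverts H) \<and> (\<forall>e\<in>uedges H. f ` e \<in> uedges G)"

lemma simple_edge_verts:
  assumes "simple_graph G" "{u, v} \<in> uedges G"
  shows "u \<in> uverts G" "v \<in> uverts G" "u \<noteq> v"
  using assms by (auto simp: simple_graph_def)

lemma simple_edge_cases:
  assumes "simple_graph G" "e \<in> uedges G"
  obtains u v where "e = {u, v}" "u \<noteq> v" "u \<in> uverts G" "v \<in> uverts G"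
  using assms by (metis card_2_iff insert_subset simple_graph_def)

lemma finite_uedges: "simple_graph G \<Longrightarrow> finite (uedges G)"
  by (rule finite_subset[of _ "Pow (uverts G)"]) (auto simp: simple_graph_def)

lemma finite_copies:
  assumes "simple_graph G"
  shows "finite (copies H G)"
proof (rule finite_subset)
  show "copies H G \<subseteq> (\<lambda>(V, E). UGraph V E) ` (Pow (uverts G) \<times> Pow (uedges G))"
  proof
    fix K assume "K \<in> copies H G"
    then have "(uverts K, uedges K) \<in> Pow (uverts G) \<times> Pow (uedges G)"
      by (auto simp: copies_def is_subgraph_def)
    then show "K \<in> (\<lambda>(V, E). UGraph V E) ` (Pow (uverts G) \<times> Pow (uedges G))"
      by (intro image_eqI[of _ _ "(uverts K, uedges K)"]) auto
  qed
  show "finite ((\<lambda>(V, E). UGraph V E) ` (Pow (uverts G) \<times> Pow (uedges G)))"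
    using assms finite_uedges[OF assms] by (auto simp: simple_graph_def)
qed

lemma embedding_copy:
  assumes "simple_graph H" "embedding H G f" "f ` uverts H \<subseteq> uverts G"
  shows "UGraph (f ` uverts H) ((`) f ` uedges H) \<in> copies H G"
proof -
  have "card (f ` e) = 2" "f ` e \<subseteq> f ` uverts H" if "e \<in> uedges H" for e
    using that assms(1,2) card_image[of f e] inj_on_subset[of f "uverts H" e]
    by (auto simp: simple_graph_def embedding_def)
  then have "simple_graph (UGraph (f ` uverts H) ((`) f ` uedges H))"
    using assms(1) by (auto simp: simple_graph_def)
  then show ?thesis
    using assms by (auto simp: copies_def is_subgraph_def isomorphic_graphs_def embedding_def
        bij_betw_def intro!: exI[of _ f])
qed

lemma copy_embedding:
  assumes "K \<in> copies H G"
  obtains f where "embedding H G f" "f ` uverts H = uverts K" "uedges K = (`) f ` uedges H"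
  using assms by (auto simp: copies_def is_subgraph_def isomorphic_graphs_def embedding_def
      bij_betw_def) blast

text \<open>
  Color all edges of \<open>Z\<close> alike and all other edges pairwise differently; isolated vertices
  pad the graph to \<open>n\<close> vertices.
\<close>

lemma rainbow_ex_ge:
  fixes T :: "'a ugraph" and G :: "'b ugraph"
  assumes T: "simple_graph T" "uverts T \<subseteq> \<Union>(uedges T)"
    and G: "simple_graph G" "card (uverts G) \<le> n"
    and Z: "\<And>e f. e \<in> Z \<Longrightarrow> f \<in> Z \<Longrightarrow> e \<noteq> f \<Longrightarrow> e \<inter> f = {}"
    and hit: "\<And>f. embedding T G f \<Longrightarrow>
      \<exists>a\<in>uedges T. \<exists>b\<in>uedges T. a \<noteq> b \<and> f ` a \<in> Z \<and> f ` b \<in> Z"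
  shows "card (copies T G) \<le> rainbow_ex n T T"
proof -
  have finG: "finite (uverts G)" using G by (simp add: simple_graph_def)
  obtain h :: "'b \<Rightarrow> nat" where h: "h ` uverts G \<subseteq> {..<n}" "inj_on h (uverts G)"
    using inj_on_iff_card_le[of "uverts G" "{..<n}"] finG G(2) by auto
  define G' where "G' = UGraph {..<n} ((`) h ` uedges G)"
  have edges_sub: "e \<subseteq> uverts G" if "e \<in> uedges G" for e
    using G that by (auto simp: simple_graph_def)
  have hcard: "card (h ` e) = 2" if "e \<in> uedges G" for e
    using that G h card_image[of h e] inj_on_subset[of h "uverts G" e]
    by (auto simp: simple_graph_def)
  have G': "simple_graph G'" "card (uverts G') = n"
    using h hcard edges_sub by (fastforce simp: simple_graph_def G'_def)+
  have inj_im: "inj_on ((`) h) (uedges G)"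
    using h(2) edges_sub by (intro inj_onI) (metis inj_on_image_eq_iff)
  obtain idx :: "nat set \<Rightarrow> nat" where idx: "inj_on idx (uedges G')"
    using finite_imp_inj_to_nat_seg[OF finite_uedges[OF G'(1)]] by blast
  define Z' where "Z' = (`) h ` (Z \<inter> uedges G)"
  \<comment> \<open>Color 0 is reserved for the image of \<open>Z\<close>; \<open>Suc\<close> keeps
    the injective colors away from it.\<close>
  define c where "c e = (if e \<in> Z' then 0 else Suc (idx e))" for e
  have "e = f" if "e \<in> uedges G'" "f \<in> uedges G'" "c e = c f" "e \<inter> f \<noteq> {}" for e f
  proof (cases "e \<in> Z'")
    case True
    then have "f \<in> Z'" using that by (auto simp: c_def split: if_splits)
    with True obtain e0 f0 where ef: "e0 \<in> Z" "e0 \<in> uedges G" "e = h ` e0"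
      "f0 \<in> Z" "f0 \<in> uedges G" "f = h ` f0"
      by (auto simp: Z'_def)
    have "h ` (e0 \<inter> f0) \<noteq> {}"
      using that(4) ef edges_sub inj_on_image_Int[OF h(2), of e0 f0] by auto
    then show ?thesis using Z[of e0 f0] ef by auto
  next
    case False
    then show ?thesis using that idx by (auto simp: c_def inj_on_def split: if_splits)
  qed
  then have proper: "proper_edge_coloring G' c"
    unfolding proper_edge_coloring_def by blast
  have norain: "\<not> rainbow c K" if K: "K \<in> copies T G'" for K
  proof -
    obtain f where f: "embedding T G' f" "uedges K = (`) f ` uedges T"
      using copy_embedding[OF K] by metis
    define g where "g = inv_into (uverts G) h \<circ> f"
    have fV: "f ` uverts T \<subseteq> h ` uverts G"
    proof
      fix y assume "y \<in> f ` uverts T"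
      then obtain e where e: "e \<in> uedges T" "y \<in> f ` e" using T(2) by blast
      then have "f ` e \<in> (`) h ` uedges G" using f(1) by (auto simp: embedding_def G'_def)
      then show "y \<in> h ` uverts G" using e edges_sub by blast
    qed
    have hg: "h (g x) = f x" if "x \<in> uverts T" for x
      unfolding g_def comp_def using fV that by (intro f_inv_into_f) auto
    have edge: "g ` e \<in> uedges G \<and> h ` (g ` e) = f ` e" if e: "e \<in> uedges T" for e
    proof -
      obtain e0 where e0: "e0 \<in> uedges G" "f ` e = h ` e0"
        using f(1) e by (auto simp: embedding_def G'_def)
      have "g ` e = inv_into (uverts G) h ` (f ` e)" by (auto simp: g_def)
      also have "\<dots> = e0"
        using e0 edges_sub h(2) by (simp add: inv_into_image_cancel)
      finally show ?thesis using e0 by simp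
    qed
    have "embedding T G g"
      using f(1) edge hg by (auto simp: embedding_def inj_on_def) metis
    from hit[OF this] obtain a b where ab: "a \<in> uedges T" "b \<in> uedges T" "a \<noteq> b"
      "g ` a \<in> Z" "g ` b \<in> Z" by auto
    have sub: "a \<subseteq> uverts T" "b \<subseteq> uverts T" using ab T by (auto simp: simple_graph_def)
    have "f ` a \<in> Z'" "f ` b \<in> Z'"
      using ab edge[of a] edge[of b] unfolding Z'_def by (metis IntI imageI)+
    then have "c (f ` a) = c (f ` b)" by (simp add: c_def)
    moreover have "f ` a \<noteq> f ` b"
      using f(1) sub ab(3) by (metis embedding_def inj_on_image_eq_iff)
    ultimately show ?thesis
      unfolding rainbow_def f(2) using ab(1,2) by (meson imageI inj_onD)
  qed
  \<comment> \<open>Relabelling by \<open>h\<close> turns copies in \<open>G\<close> injectively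
    into copies in \<open>G'\<close>.\<close>
  define lift where "lift K = UGraph (h ` uverts K) ((`) h ` uedges K)" for K
  have "inj_on lift (copies T G)"
  proof (rule inj_onI)
    fix K K' assume *: "K \<in> copies T G" "K' \<in> copies T G" "lift K = lift K'"
    then have sub: "uverts K \<subseteq> uverts G" "uverts K' \<subseteq> uverts G"
      "uedges K \<subseteq> uedges G" "uedges K' \<subseteq> uedges G"
      by (auto simp: copies_def is_subgraph_def)
    have "uverts K = uverts K'"
      using *(3) sub h(2) inj_on_image_eq_iff by (fastforce simp: lift_def)
    moreover have "uedges K = uedges K'"
      using *(3) sub inj_on_image_eq_iff[OF inj_im] by (simp add: lift_def)
    ultimately show "K = K'" by (simp add: ugraph.expand)
  qed
  moreover have "lift ` copies T G \<subseteq> copies T G'"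
  proof
    fix K' assume "K' \<in> lift ` copies T G"
    then obtain K where K: "K \<in> copies T G" "K' = lift K" by auto
    obtain f where f: "embedding T G f" "f ` uverts T = uverts K" "uedges K = (`) f ` uedges T"
      using copy_embedding[OF K(1)] .
    have sub: "uverts K \<subseteq> uverts G" using K by (auto simp: copies_def is_subgraph_def)
    have "(h \<circ> f) ` e = h ` (f ` e)" for e by auto
    then have "embedding T G' (h \<circ> f)"
      using f(1) inj_on_subset[OF h(2) sub] unfolding embedding_def G'_def f(2)[symmetric]
      by (simp add: comp_inj_on)
    moreover have hK: "(h \<circ> f) ` uverts T = h ` uverts K"
      unfolding f(2)[symmetric] by (rule image_comp[symmetric])
    then have "(h \<circ> f) ` uverts T \<subseteq> uverts G'"
      using h(1) sub by (auto simp: G'_def)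
    ultimately have "UGraph ((h \<circ> f) ` uverts T) ((`) (h \<circ> f) ` uedges T) \<in> copies T G'"
      using embedding_copy[OF T(1)] by blast
    moreover have "UGraph ((h \<circ> f) ` uverts T) ((`) (h \<circ> f) ` uedges T) = lift K"
      unfolding lift_def hK f(3) by (simp add: image_image image_comp)
    ultimately show "K' \<in> copies T G'" using K by simp
  qed
  ultimately have "card (copies T G) \<le> card (copies T G')"
    using finite_copies[OF G'(1)] card_inj_on_le by blast
  also have "\<dots> \<le> rainbow_ex n T T"
    unfolding rainbow_ex_def
  proof (rule Max_ge[OF finite_rainbow_ex_counts])
    show "card (copies T G') \<in> rainbow_ex_counts n T T"
      unfolding rainbow_ex_counts_def using G' proper norain by blast
  qed
  finally show ?thesis .
qed

subsection \<open>Blow-ups\<close>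

definition slots :: "'a set \<Rightarrow> nat \<Rightarrow> 'a \<Rightarrow> nat set" where
  "slots W N v = (if v \<in> W then {..<N} else {0})"

text \<open>Matching equal indices, instead of joining all pairs, keeps the edges over
  \<open>W\<close> a matching whenever \<open>T[W]\<close> is one; a proper coloring may then give
  all of them one color.\<close>

definition blowup :: "'a ugraph \<Rightarrow> 'a set \<Rightarrow> nat \<Rightarrow> ('a \<times> nat) ugraph" where
  "blowup T W N = UGraph (SIGMA v : uverts T. slots W N v)
     {{(u, i), (v, j)} | u i v j. {u, v} \<in> uedges T \<and> i \<in> slots W N u \<and> j \<in> slots W N v \<and>
        (u \<in> W \<longrightarrow> v \<in> W \<longrightarrow> i = j)}"

text \<open>The defining condition is symmetric in the two ends, so the order in which an edge is
  written does not matter.\<close>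

lemma blowup_edge_iff:
  "{(u, i), (v, j)} \<in> uedges (blowup T W N) \<longleftrightarrow>
     {u, v} \<in> uedges T \<and> i \<in> slots W N u \<and> j \<in> slots W N v \<and>
     (u \<in> W \<longrightarrow> v \<in> W \<longrightarrow> i = j)" (is "?L \<longleftrightarrow> ?R")
proof
  assume ?L
  then obtain u' i' v' j' where *: "{(u, i), (v, j)} = {(u', i'), (v', j')}"
    "{u', v'} \<in> uedges T" "i' \<in> slots W N u'" "j' \<in> slots W N v'"
    "u' \<in> W \<longrightarrow> v' \<in> W \<longrightarrow> i' = j'"
    unfolding blowup_def by auto
  from *(1) consider "u = u'" "i = i'" "v = v'" "j = j'" | "u = v'" "i = j'" "v = u'" "j = i'"
    unfolding doubleton_eq_iff by blast
  then show ?R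
    by cases (use *(2-) in \<open>auto simp: insert_commute\<close>)
next
  assume ?R
  then show ?L unfolding blowup_def ugraph.sel by blast
qed

lemma simple_blowup:
  assumes "simple_graph T"
  shows "simple_graph (blowup T W N)"
proof -
  have "finite (uverts (blowup T W N))"
    using assms by (auto simp: simple_graph_def blowup_def slots_def)
  moreover have "e \<subseteq> uverts (blowup T W N) \<and> card e = 2" if "e \<in> uedges (blowup T W N)" for e
  proof -
    from that obtain u i v j where e: "e = {(u, i), (v, j)}" "{u, v} \<in> uedges T"
      "i \<in> slots W N u" "j \<in> slots W N v"
      unfolding blowup_def ugraph.sel by blast
    then show ?thesis
      using simple_edge_verts[OF assms e(2)] by (auto simp: blowup_def)
  qed
  ultimately show ?thesis by (simp add: simple_graph_def)
qed

lemma card_blowup: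
  assumes "simple_graph T" "N \<ge> 1"
  shows "card (uverts (blowup T W N)) \<le> card (uverts T) * N"
proof -
  \<comment> \<open>\<open>N \<ge> 1\<close> puts the single slot 0 of the other vertices into the
    range.\<close>
  have "uverts (blowup T W N) \<subseteq> uverts T \<times> {..<N}"
    using assms by (auto simp: blowup_def slots_def split: if_splits)
  moreover have "finite (uverts T \<times> {..<N})" using assms by (simp add: simple_graph_def)
  ultimately have "card (uverts (blowup T W N)) \<le> card (uverts T \<times> {..<N})"
    by (intro card_mono)
  then show ?thesis by (simp add: card_cartesian_product)
qed

text \<open>
  \<open>\<rho>\<close> names the components of the subgraph induced by \<open>W\<close>: the copy number may be chosen
  independently for each of them.
\<close>

lemma card_copies_blowup:
  assumes T: "simple_graph T" and W: "W \<subseteq> uverts T"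
    and \<rho>: "\<And>u v. u \<in> W \<Longrightarrow> v \<in> W \<Longrightarrow> {u, v} \<in> uedges T \<Longrightarrow> \<rho> u = \<rho> v"
  shows "N ^ card (\<rho> ` W) \<le> card (copies T (blowup T W N))"
proof -
  \<comment> \<open>\<open>\<phi>\<close> chooses an index for each component, and
    \<open>emb \<phi>\<close> places the whole component at that index.\<close>
  define F where "F = PiE (\<rho> ` W) (\<lambda>_. {..<N})"
  define emb where "emb \<phi> v = (v, if v \<in> W then \<phi> (\<rho> v) else 0 :: nat)" for \<phi> v
  define C where "C \<phi> = UGraph (emb \<phi> ` uverts T) ((`) (emb \<phi>) ` uedges T)" for \<phi>
  have finW: "finite W" using T W finite_subset by (auto simp: simple_graph_def)
  have bound: "(if v \<in> W then \<phi> (\<rho> v) else 0 :: nat) \<in> slots W N v"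
    if "\<phi> \<in> F" for \<phi> v
    using that by (auto simp: F_def slots_def)
  have sub: "C ` F \<subseteq> copies T (blowup T W N)"
  proof (rule image_subsetI)
    fix \<phi> assume \<phi>: "\<phi> \<in> F"
    have "emb \<phi> ` e \<in> uedges (blowup T W N)" if e: "e \<in> uedges T" for e
    proof -
      obtain u v where uv: "e = {u, v}" using simple_edge_cases[OF T e] by metis
      show ?thesis
        using e bound[OF \<phi>, of u] bound[OF \<phi>, of v] \<rho>[of u v]
        unfolding uv image_insert image_empty emb_def blowup_edge_iff by simp
    qed
    then have "embedding T (blowup T W N) (emb \<phi>)"
      by (auto simp: embedding_def inj_on_def emb_def)
    moreover have "emb \<phi> ` uverts T \<subseteq> uverts (blowup T W N)"
      using bound[OF \<phi>] by (auto simp: blowup_def emb_def)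
    ultimately show "C \<phi> \<in> copies T (blowup T W N)"
      unfolding C_def by (rule embedding_copy[OF T])
  qed
  have inj: "inj_on C F"
  proof (rule inj_onI)
    fix \<phi> \<psi> assume *: "\<phi> \<in> F" "\<psi> \<in> F" "C \<phi> = C \<psi>"
    \<comment> \<open>First coordinates identify \<open>w\<close>, so the vertex set of the copy
      alone determines the index chosen for the component of \<open>w\<close>.\<close>
    have "\<phi> (\<rho> w) = \<psi> (\<rho> w)" if "w \<in> W" for w
    proof -
      have "emb \<phi> w \<in> emb \<psi> ` uverts T" using * that W by (auto simp: C_def)
      then show ?thesis using that by (auto simp: emb_def split: if_splits)
    qed
    then show "\<phi> = \<psi>"
      using PiE_ext[OF *(1,2)[unfolded F_def]] by blast
  qed
  have "card F \<le> card (copies T (blowup T W N))"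
    by (rule card_inj_on_le[OF inj sub finite_copies[OF simple_blowup[OF T]]])
  then show ?thesis using finW by (simp add: F_def card_PiE)
qed

text \<open>Take \<open>N\<close> as \<open>n div t\<close>. For \<open>n \<ge> t\<close> the
  remainder is below \<open>t * N\<close>, so \<open>N\<close> is at least \<open>n / (2 t)\<close>;
  and \<open>k\<close> is at least \<open>\<lceil>t / 4\<rceil>\<close>, so lowering the exponent
  only weakens the bound.\<close>

lemma bigomega_of_blowup:
  assumes t: "t \<ge> 1" "4 * k \<ge> t"
    and lower: "\<And>n N. N \<ge> 1 \<Longrightarrow> t * N \<le> n \<Longrightarrow> N ^ k \<le> r n"
  shows "(\<lambda>n. real (r n)) \<in> \<Omega>(\<lambda>n. real n ^ nat \<lceil>real t / 4\<rceil>)"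
proof -
  define m where "m = nat \<lceil>real t / 4\<rceil>"
  have "m \<le> k" using t unfolding m_def by linarith
  have "(1 / (2 * real t)) ^ m * real n ^ m \<le> real (r n)" if n: "n \<ge> t" for n
  proof -
    define N where "N = n div t"
    have N: "N \<ge> 1" using n t by (simp add: N_def Suc_le_eq div_greater_zero_iff)
    have tN: "t * N \<le> n" by (simp add: N_def)
    have "n mod t < t" "t * N + n mod t = n" using t by (auto simp: N_def)
    moreover have "t \<le> t * N" using N by simp
    ultimately have "n \<le> 2 * t * N" by linarith
    then have "real n \<le> 2 * real t * real N"
      by (metis of_nat_le_iff of_nat_mult of_nat_numeral)
    then have "real n / (2 * real t) \<le> real N" using t by (simp add: field_simps)
    then have "(real n / (2 * real t)) ^ m \<le> real N ^ m" by (intro power_mono) auto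
    also have "\<dots> \<le> real N ^ k" using N \<open>m \<le> k\<close> by (intro power_increasing) auto
    also have "\<dots> \<le> real (r n)" using lower[OF N tN] by (metis of_nat_le_iff of_nat_power)
    finally show ?thesis by (simp add: power_divide power_mult_distrib)
  qed
  then show ?thesis
    unfolding m_def[symmetric] using t
    by (intro landau_omega.bigI[of "(1 / (2 * real t)) ^ m"])
       (auto intro!: eventually_sequentiallyI[of t])
qed

subsection \<open>Trees\<close>

text \<open>
  \<open>D\<close> is the set of non-roots, \<open>\<pi>\<close> the parent map, \<open>d\<close> the depth.  Consider a deepest vertex
  \<open>y\<close> that has a child.  If some vertex at its depth has two children, delete it and split off
  its children; otherwise delete the parent of \<open>y\<close> and split off its descendants, which form
  components of at most two vertices.  Each deletion pays for at least three vertices.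
\<close>

lemma forest_dissociation:
  fixes \<pi> :: "'a \<Rightarrow> 'a" and d :: "'a \<Rightarrow> nat" and D :: "'a set"
  assumes d: "\<And>v. v \<in> D \<Longrightarrow> d v = Suc (d (\<pi> v))"
  defines "adj \<equiv> \<lambda>x y. (x \<in> D \<and> \<pi> x = y) \<or> (y \<in> D \<and> \<pi> y = x)"
  assumes "finite A"
  shows "\<exists>U\<subseteq>A. 3 * card U \<le> card A \<and>
    (\<forall>x\<in>A-U. \<forall>y\<in>A-U. \<forall>z\<in>A-U. adj x y \<longrightarrow> adj x z \<longrightarrow> y = z)"
  using \<open>finite A\<close>
proof (induction A rule: finite_psubset_induct)
  case (psubset A)
  define ch where "ch y = {x \<in> A. x \<in> D \<and> \<pi> x = y}" for y
  have fin_ch: "finite (ch y)" for y using psubset.hyps by (simp add: ch_def)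
  define P where "P = {y \<in> A. ch y \<noteq> {}}"
  let ?goal = "\<exists>U\<subseteq>A. 3 * card U \<le> card A \<and>
    (\<forall>x\<in>A-U. \<forall>y\<in>A-U. \<forall>z\<in>A-U. adj x y \<longrightarrow> adj x z \<longrightarrow> y = z)"
  \<comment> \<open>Splitting off a block \<open>B\<close> and deleting \<open>X\<close> from it: no
    adjacency leads from \<open>B - X\<close> to \<open>A - B\<close>, so the set found for
    \<open>A - B\<close> can be extended by \<open>X\<close>.\<close>
  have step: ?goal
    if B: "B \<subseteq> A" "B \<noteq> {}" "X \<subseteq> B" "3 * card X \<le> card B"
      and sep: "\<And>x y. x \<in> B - X \<Longrightarrow> y \<in> A - B \<Longrightarrow> \<not> adj x y"
      and ok: "\<And>x y z. x \<in> B - X \<Longrightarrow> y \<in> B - X \<Longrightarrow> z \<in> B - X \<Longrightarrow> adj x y \<Longrightarrow> adj x z \<Longrightarrow> y = z"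
    for B X
  proof -
    have sym: "adj x y \<longleftrightarrow> adj y x" for x y by (auto simp: adj_def)
    have "A - B \<subset> A" using B by auto
    from psubset.IH[OF this] obtain U where U: "U \<subseteq> A - B" "3 * card U \<le> card (A - B)"
      "\<forall>x\<in>A-B-U. \<forall>y\<in>A-B-U. \<forall>z\<in>A-B-U. adj x y \<longrightarrow> adj x z \<longrightarrow> y = z" by blast
    have fin: "finite B" "finite X" "finite U"
      using B U psubset.hyps by (meson finite_Diff finite_subset)+
    have "card (U \<union> X) = card U + card X"
      using fin U B by (intro card_Un_disjoint) auto
    moreover have "card A = card (A - B) + card B"
      using B fin by (metis card_Diff_subset card_mono le_add_diff_inverse2 psubset.hyps)
    ultimately have "3 * card (U \<union> X) \<le> card A" using U B by linarith
    moreover have "U \<union> X \<subseteq> A" using U B by auto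
    moreover have "y = z" if "x \<in> A - (U \<union> X)" "y \<in> A - (U \<union> X)" "z \<in> A - (U \<union> X)"
      "adj x y" "adj x z" for x y z
    proof (cases "x \<in> B")
      case True
      then have "y \<in> B" "z \<in> B" using that sep by blast+
      then show ?thesis using True that ok by blast
    next
      case False
      then have "y \<notin> B" "z \<notin> B" using that sep sym by blast+
      then show ?thesis using False that U(3) by blast
    qed
    ultimately show ?thesis by blast
  qed
  have adj_iff: "adj u v \<longleftrightarrow> u \<in> ch v \<or> v \<in> ch u" if "u \<in> A" "v \<in> A" for u v
    using that by (auto simp: adj_def ch_def)
  have ch_uniq: "v = w" if "u \<in> ch v" "u \<in> ch w" for u v w
    using that by (simp add: ch_def)
  have chA: "ch v \<subseteq> A" for v by (auto simp: ch_def)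
  have d_ch: "d u = Suc (d v)" if "u \<in> ch v" for u v
    using d[of u] that by (simp add: ch_def)
  have ch_irrefl: "v \<notin> ch v" for v using d_ch[of v v] by auto
  show ?case
  proof (cases "P = {}")
    case True
    then have "\<not> adj x y" if "x \<in> A" "y \<in> A" for x y
      using that adj_iff[OF that] by (auto simp: P_def)
    then show ?thesis by (intro exI[of _ "{}"]) auto
  next
    case False
    have "finite P" using psubset.hyps by (simp add: P_def)
    then have "Max (d ` P) \<in> d ` P" using False by (intro Max_in) auto
    then obtain y where "y \<in> P" "d y = Max (d ` P)" by auto
    then have y: "y \<in> P" "\<And>z. z \<in> P \<Longrightarrow> d z \<le> d y"
      using \<open>finite P\<close> by simp_all
    \<comment> \<open>No parent lies deeper than \<open>y\<close>, so the children of vertices at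
      this depth are childless.\<close>
    have bottom: "ch x = {}" if "x \<in> ch y'" "d y' = d y" for x y'
    proof (rule ccontr)
      assume "ch x \<noteq> {}"
      then have "x \<in> P" using that(1) chA by (auto simp: P_def)
      then have "d x \<le> d y" by (rule y(2))
      then show False using d_ch[OF that(1)] that(2) by simp
    qed
    show ?thesis
    proof (cases "\<exists>y'\<in>P. d y' = d y \<and> card (ch y') \<ge> 2")
      case True
      then obtain y' where y': "y' \<in> P" "d y' = d y" "card (ch y') \<ge> 2" by blast
      have up: "v = y'" if "u \<in> ch y'" "v \<in> A" "adj u v" for u v
        using that chA adj_iff[of u v] bottom[OF that(1) y'(2)] ch_uniq[OF that(1)] by blast
      show ?thesis
      proof (rule step[of "insert y' (ch y')" "{y'}"])
        show "insert y' (ch y') \<subseteq> A" using y' chA by (auto simp: P_def)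
        show "3 * card {y'} \<le> card (insert y' (ch y'))" using ch_irrefl y' fin_ch by simp
        show "\<not> adj u v" if "u \<in> insert y' (ch y') - {y'}" "v \<in> A - insert y' (ch y')" for u v
          using that up by blast
        show "v = w" if "u \<in> insert y' (ch y') - {y'}" "v \<in> insert y' (ch y') - {y'}"
          "w \<in> insert y' (ch y') - {y'}" "adj u v" "adj u w" for u v w
          using that up chA by blast
      qed auto
    next
      case noTwo: False
      have one: "x = x'" if "x \<in> ch y'" "x' \<in> ch y'" "y' \<in> A" "d y' = d y" for x x' y'
      proof -
        have "y' \<in> P" using that by (auto simp: P_def)
        then have "\<not> card (ch y') \<ge> 2" using noTwo that by blast
        then have "card (ch y') \<le> Suc 0" by simp
        then show ?thesis using that fin_ch card_le_Suc0_iff_eq[of "ch y'"] by auto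
      qed
      obtain x where x: "x \<in> ch y" using y by (auto simp: P_def)
      have yA: "y \<in> A" using y by (simp add: P_def)
      show ?thesis
      proof (cases "\<exists>z\<in>A. y \<in> ch z")
        \<comment> \<open>Here \<open>y\<close> has no parent in \<open>A\<close>: the pair
          \<open>{y, x}\<close> is a whole component and splits off with nothing deleted.\<close>
        case False
        have nx: "v = y" if "v \<in> A" "adj x v" for v
          using that chA x adj_iff[of x v] bottom[OF x refl] ch_uniq[OF x] by blast
        have ny: "v = x" if "v \<in> A" "adj y v" for v
          using that yA adj_iff[of y v] False one[OF _ x yA refl] by blast
        show ?thesis
        proof (rule step[of "{y, x}" "{}"])
          show "{y, x} \<subseteq> A" using yA x chA by auto
          show "\<not> adj u v" if "u \<in> {y, x} - {}" "v \<in> A - {y, x}" for u v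
            using that nx ny by blast
          show "v = w" if "u \<in> {y, x} - {}" "v \<in> {y, x} - {}" "w \<in> {y, x} - {}"
            "adj u v" "adj u w" for u v w
            using that nx ny yA x chA by blast
        qed auto
      next
        case True
        then obtain z where z: "z \<in> A" "y \<in> ch z" by blast
        \<comment> \<open>Each child of \<open>z\<close> has at most one child, since no vertex at
          the depth of \<open>y\<close> has two. Hence \<open>B - {z}\<close> falls into components
          of at most two vertices.\<close>
        define B where "B = insert z (ch z \<union> (\<Union>c\<in>ch z. ch c))"
        have dz: "d y = Suc (d z)" using d_ch[OF z(2)] .
        have dc: "d c = d y" if "c \<in> ch z" for c using d_ch[OF that] dz by simp
        have B_cases: "u = z \<or> u \<in> ch z \<or> (\<exists>c\<in>ch z. u \<in> ch c)" if "u \<in> B" for u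
          using that by (auto simp: B_def)
        have BA: "B \<subseteq> A" using z chA by (auto simp: B_def)
        have up: "v = c" if "c \<in> ch z" "u \<in> ch c" "adj u v" "v \<in> A" for u c v
          using that chA adj_iff[of u v] bottom[OF that(2) dc[OF that(1)]] ch_uniq[OF that(2)]
          by blast
        have down: "v = z \<or> v \<in> ch u" if "u \<in> ch z" "adj u v" "v \<in> A" for u v
          using that chA adj_iff[of u v] ch_uniq[OF that(1)] by blast
        show ?thesis
        proof (rule step[of B "{z}"])
          show "B \<subseteq> A" by (rule BA)
          have fB: "finite B" using psubset.hyps BA finite_subset by blast
          \<comment> \<open>Three different depths give three vertices of \<open>B\<close>, which
            pay for \<open>z\<close>.\<close>
          have "z \<noteq> y" "z \<noteq> x" "y \<noteq> x" using dz d_ch[OF x] by auto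
          then have "card {z, y, x} = 3" by simp
          moreover have "{z, y, x} \<subseteq> B" using x z by (auto simp: B_def)
          ultimately show "3 * card {z} \<le> card B" using card_mono[OF fB, of "{z, y, x}"] by simp
          show "\<not> adj u v" if u: "u \<in> B - {z}" and v: "v \<in> A - B" for u v
          proof
            assume a: "adj u v"
            from u consider "u \<in> ch z" | c where "c \<in> ch z" "u \<in> ch c"
              using B_cases by blast
            then show False
            proof cases
              case 1
              then have "v \<in> B" using down[OF 1 a] v by (auto simp: B_def)
              then show False using v by blast
            next
              case 2
              then have "v \<in> B" using up[OF 2 a] v by (auto simp: B_def)
              then show False using v by blast
            qed
          qed
          show "v = w" if uvw: "u \<in> B - {z}" "v \<in> B - {z}" "w \<in> B - {z}" "adj u v" "adj u w"
            for u v w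
          proof -
            have A: "v \<in> A" "w \<in> A" using uvw BA by auto
            from uvw consider "u \<in> ch z" | c where "c \<in> ch z" "u \<in> ch c"
              using B_cases by blast
            then show ?thesis
            proof cases
              case 1
              then have "v \<in> ch u" "w \<in> ch u" using down[OF 1] uvw A by blast+
              then show ?thesis using one dc[OF 1] 1 chA by blast
            next
              case 2
              then show ?thesis using up[OF 2] uvw A by blast
            qed
          qed
        qed (auto simp: B_def)
      qed
    qed
  qed
qed

section \<open>Paths, rooted trees and the number of edges\<close>

lemma adjacent_commute: "adjacent G u v \<longleftrightarrow> adjacent G v u"
  by (simp add: adjacent_def insert_commute)

lemma graph_path_appendD1:
  assumes "graph_path G (p @ q)" "p \<noteq> []"
  shows "graph_path G p"
  using assms by (auto simp: graph_path_def successively_append_iff)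

lemma graph_path_appendD2:
  assumes "graph_path G (p @ q)" "q \<noteq> []"
  shows "graph_path G q"
  using assms by (auto simp: graph_path_def successively_append_iff)

lemma successively_adjacent_rev:
  "successively (adjacent G) (rev p) \<longleftrightarrow> successively (adjacent G) p"
  unfolding successively_rev by (simp add: adjacent_commute)

text \<open>Two paths with the same ends that diverge close up to a cycle: go along \<open>p\<close>
  to the first vertex that \<open>q\<close> visits as well, and return along
  \<open>q\<close>.\<close>

lemma graph_path_unique:
  assumes acyc: "\<nexists>p. graph_cycle G p"
    and "graph_path G p" "graph_path G q" "hd p = hd q" "last p = last q"
  shows "p = q"
  using assms(2-)
proof (induction p arbitrary: q)
  case Nil
  then show ?case by (simp add: graph_path_def)
next
  case (Cons u p)
  then obtain q' where q: "q = u # q'" by (cases q) (auto simp: graph_path_def)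
  have dist: "distinct (u # p)" "distinct (u # q')"
    using Cons.prems q by (auto simp: graph_path_def)
  have succ: "successively (adjacent G) (u # p)" "successively (adjacent G) (u # q')"
    using Cons.prems q by (auto simp: graph_path_def)
  have verts: "set (u # p) \<subseteq> uverts G" "set (u # q') \<subseteq> uverts G"
    using Cons.prems q by (auto simp: graph_path_def)
  show ?case
  proof (cases "p = [] \<or> q' = []")
    case True
    have "p = [] \<longleftrightarrow> q' = []"
      using dist Cons.prems(4) q last_in_set[of p] last_in_set[of q'] by (auto split: if_splits)
    then show ?thesis using True q by auto
  next
    case False
    have paths: "graph_path G p" "graph_path G q'"
      using graph_path_appendD2[of G "[u]" p] graph_path_appendD2[of G "[u]" q']
        Cons.prems q False by auto
    have lasts: "last p = last q'" using Cons.prems(4) q False by simp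
    have "hd p = hd q'"
    proof (rule ccontr)
      assume ne: "hd p \<noteq> hd q'"
      have "\<exists>x\<in>set p. x \<in> set q'" using False lasts by (metis last_in_set)
      \<comment> \<open>Since \<open>z\<close> is the first common vertex, \<open>p1\<close> is
        disjoint from \<open>q'\<close> and \<open>C\<close> repeats no vertex.\<close>
      then obtain p1 z p2 where p: "p = p1 @ z # p2" "z \<in> set q'" "\<forall>x\<in>set p1. x \<notin> set q'"
        using split_list_first_prop[of p "\<lambda>x. x \<in> set q'"] by blast
      then obtain q1 q2 where q': "q' = q1 @ z # q2" by (meson split_list)
      define C where "C = (u # p1 @ [z]) @ rev q1"
      have s1: "successively (adjacent G) (u # p1 @ [z])"
        using succ(1) successively_append_iff[of "adjacent G" "u # p1 @ [z]" p2] p by simp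
      have s2: "successively (adjacent G) (u # q1 @ [z])"
        using succ(2) successively_append_iff[of "adjacent G" "u # q1 @ [z]" q2] q' by simp
      then have s3: "successively (adjacent G) (z # rev q1 @ [u])"
        using successively_adjacent_rev[of G "u # q1 @ [z]"] by simp
      then have s4: "successively (adjacent G) (z # rev q1)" "adjacent G (last (z # rev q1)) u"
        using successively_append_iff[of "adjacent G" "z # rev q1" "[u]"] by simp_all
      have "successively (adjacent G) C"
        using s1 s4 unfolding C_def successively_append_iff
        by (auto simp: successively_Cons split: if_splits)
      moreover have "distinct C" using dist p q' unfolding C_def by auto
      moreover have "set C \<subseteq> uverts G" using verts p q' unfolding C_def by auto
      ultimately have "graph_path G C" by (simp add: graph_path_def C_def)
      \<comment> \<open>\<open>p1\<close> and \<open>q1\<close> are not both empty, as the paths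
        differ in the vertex after \<open>u\<close>.\<close>
      moreover have "length C \<ge> 3"
        using ne p q' by (cases p1; cases q1) (auto simp: C_def)
      moreover have "adjacent G (last C) (hd C)"
        using s4(2) by (simp add: C_def last_append)
      ultimately show False using acyc by (auto simp: graph_cycle_def)
    qed
    then show ?thesis using Cons.IH[OF paths _ lasts] q by simp
  qed
qed

text \<open>Root \<open>T\<close> at \<open>r\<close>: \<open>\<pi> v\<close> is the last but one
  vertex of the unique path from \<open>r\<close> to \<open>v\<close>, and \<open>d v\<close> counts
  the vertices of this path, so that the root has depth 1.\<close>

lemma tree_parent:
  assumes T: "is_tree T" and r: "r \<in> uverts T"
  shows "\<exists>\<pi> d. (\<forall>v\<in>uverts T - {r}. d v = Suc (d (\<pi> v)) \<and> {v, \<pi> v} \<in> uedges T) \<and>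
    (\<forall>u v. {u, v} \<in> uedges T \<longrightarrow>
      (u \<in> uverts T - {r} \<and> \<pi> u = v) \<or> (v \<in> uverts T - {r} \<and> \<pi> v = u))"
proof -
  have sg: "simple_graph T" and conn: "connected_graph T" and acyc: "\<nexists>p. graph_cycle T p"
    using T by (auto simp: is_tree_def)
  note uniq = graph_path_unique[OF acyc]
  have "\<forall>v\<in>uverts T. \<exists>p. graph_path T p \<and> hd p = r \<and> last p = v"
    using conn r by (auto simp: connected_graph_def)
  then obtain P where P: "\<And>v. v \<in> uverts T \<Longrightarrow> graph_path T (P v) \<and> hd (P v) = r \<and> last (P v) = v"
    by metis
  define \<pi> where "\<pi> v = last (butlast (P v))" for v
  define d where "d v = length (P v)" for v
  have P_eq: "P v = p" if "graph_path T p" "hd p = r" "last p = v" for v p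
  proof -
    have "v \<in> uverts T" using that by (auto simp: graph_path_def)
    then show ?thesis using P[of v] that uniq[of "P v" p] by simp
  qed
  have Pr: "P r = [r]" using r by (intro P_eq) (auto simp: graph_path_def)
  have parent: "d v = Suc (d (\<pi> v)) \<and> {v, \<pi> v} \<in> uedges T" if v: "v \<in> uverts T - {r}" for v
  proof -
    have Pv: "graph_path T (P v)" "hd (P v) = r" "last (P v) = v" using P v by auto
    define q where "q = butlast (P v)"
    have "P v \<noteq> []" using Pv by (simp add: graph_path_def)
    then have q: "P v = q @ [v]" using Pv(3) append_butlast_last_id[of "P v"] by (simp add: q_def)
    have "q \<noteq> []" using Pv(2) q v by auto
    then have "graph_path T q" "hd q = r"
      using graph_path_appendD1[of T q "[v]"] Pv q by auto
    then have "P (last q) = q" by (intro P_eq) auto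
    moreover have "adjacent T (last q) v"
      using Pv(1) \<open>q \<noteq> []\<close> unfolding q graph_path_def successively_append_iff by auto
    ultimately show ?thesis
      using q by (simp add: \<pi>_def d_def q_def[symmetric] adjacent_def insert_commute)
  qed
  have edge: "(u \<in> uverts T - {r} \<and> \<pi> u = v) \<or> (v \<in> uverts T - {r} \<and> \<pi> v = u)"
    if e: "{u, v} \<in> uedges T" for u v
  proof -
    have uv: "u \<in> uverts T" "v \<in> uverts T" "u \<noteq> v" using simple_edge_verts[OF sg e] by auto
    note Pu = P[OF uv(1)]
    have ne: "P u \<noteq> []" using Pu by (simp add: graph_path_def)
    show ?thesis
    proof (cases "v \<in> set (P u)")
      \<comment> \<open>The path to \<open>u\<close> extends by \<open>v\<close>, which makes
        \<open>u\<close> the parent of \<open>v\<close>.\<close>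
      case False
      have "graph_path T (P u @ [v])"
        using Pu False uv e ne by (auto simp: graph_path_def successively_append_iff adjacent_def)
      then have "P v = P u @ [v]" using Pu ne by (intro P_eq) auto
      moreover have "v \<noteq> r" using False Pu ne hd_in_set[of "P u"] by auto
      ultimately show ?thesis using Pu uv by (simp add: \<pi>_def)
    next
      case True
      then obtain a b where ab: "P u = a @ v # b" by (meson split_list)
      have "b \<noteq> []" using ab Pu uv by auto
      have vb: "graph_path T (v # b)" using graph_path_appendD2[of T a "v # b"] Pu ab by simp
      have lb: "last b = u" using Pu ab \<open>b \<noteq> []\<close> by simp
      \<comment> \<open>The stretch from \<open>v\<close> to \<open>u\<close> would close up to a
        cycle if it had three or more vertices.\<close>
      have "\<not> graph_cycle T (v # b)" using acyc by blast
      then have "length b < 2"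
        using vb lb e \<open>b \<noteq> []\<close> by (auto simp: graph_cycle_def adjacent_def)
      then have "b = [u]" using lb \<open>b \<noteq> []\<close> by (cases b) auto
      then have "P u = (a @ [v]) @ [u]" using ab by simp
      then have "\<pi> u = v" by (simp add: \<pi>_def butlast_append)
      moreover have "u \<noteq> r" using Pr \<open>P u = (a @ [v]) @ [u]\<close> by auto
      ultimately show ?thesis using uv by simp
    qed
  qed
  show ?thesis using parent edge by blast
qed

text \<open>Each non-root vertex corresponds to the edge to its parent. Two vertices cannot be each
  other's parent, because the depth increases from parent to child.\<close>

lemma tree_card_edges:
  fixes T :: "'a ugraph"
  assumes T: "is_tree T"
  shows "card (uverts T) = Suc (card (uedges T))"
proof -
  have sg: "simple_graph T" and ne: "uverts T \<noteq> {}"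
    using T by (auto simp: is_tree_def connected_graph_def)
  then obtain r where r: "r \<in> uverts T" by blast
  obtain \<pi> :: "'a \<Rightarrow> 'a" and d :: "'a \<Rightarrow> nat" where *:
    "\<And>v. v \<in> uverts T - {r} \<Longrightarrow> d v = Suc (d (\<pi> v))"
    "\<And>v. v \<in> uverts T - {r} \<Longrightarrow> {v, \<pi> v} \<in> uedges T"
    "\<And>u v. {u, v} \<in> uedges T \<Longrightarrow>
      (u \<in> uverts T - {r} \<and> \<pi> u = v) \<or> (v \<in> uverts T - {r} \<and> \<pi> v = u)"
    using tree_parent[OF T r] by metis
  have "bij_betw (\<lambda>v. {v, \<pi> v}) (uverts T - {r}) (uedges T)"
  proof (rule bij_betw_imageI)
    show "inj_on (\<lambda>v. {v, \<pi> v}) (uverts T - {r})"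
    proof (rule inj_onI)
      fix u v assume uv: "u \<in> uverts T - {r}" "v \<in> uverts T - {r}" "{u, \<pi> u} = {v, \<pi> v}"
      show "u = v"
      proof (rule ccontr)
        assume "u \<noteq> v"
        then have "u = \<pi> v" "v = \<pi> u" using uv(3) by (auto simp: doubleton_eq_iff)
        then show False using *(1)[OF uv(1)] *(1)[OF uv(2)] by simp
      qed
    qed
    show "(\<lambda>v. {v, \<pi> v}) ` (uverts T - {r}) = uedges T"
    proof (intro equalityI subsetI)
      fix e assume e: "e \<in> uedges T"
      then obtain u v where uv: "e = {u, v}" using simple_edge_cases[OF sg] by metis
      then show "e \<in> (\<lambda>v. {v, \<pi> v}) ` (uverts T - {r})"
        using *(3)[of u v] e by auto
    qed (use *(2) in auto)
  qed
  then have "card (uverts T - {r}) = card (uedges T)" by (rule bij_betw_same_card)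
  then show ?thesis
    using r sg card_Suc_Diff1[of "uverts T" r] by (simp add: simple_graph_def)
qed

text \<open>\<open>forest_dissociation\<close> applies to \<open>T\<close> rooted anywhere. That no
  vertex has two neighbors outside \<open>U\<close> encodes that the components of
  \<open>T - U\<close> have at most two vertices.\<close>

lemma tree_dissociation:
  fixes T :: "'a ugraph"
  assumes T: "is_tree T"
  obtains U where "U \<subseteq> uverts T" "3 * card U \<le> card (uverts T)"
    "\<And>x y z. x \<in> uverts T - U \<Longrightarrow> y \<in> uverts T - U \<Longrightarrow> z \<in> uverts T - U \<Longrightarrow>
      {x, y} \<in> uedges T \<Longrightarrow> {x, z} \<in> uedges T \<Longrightarrow> y = z"
proof -
  have sg: "simple_graph T" and ne: "uverts T \<noteq> {}"
    using T by (auto simp: is_tree_def connected_graph_def)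
  then obtain r where r: "r \<in> uverts T" by blast
  obtain \<pi> :: "'a \<Rightarrow> 'a" and d :: "'a \<Rightarrow> nat" where *:
    "\<And>v. v \<in> uverts T - {r} \<Longrightarrow> d v = Suc (d (\<pi> v))"
    "\<And>v. v \<in> uverts T - {r} \<Longrightarrow> {v, \<pi> v} \<in> uedges T"
    "\<And>u v. {u, v} \<in> uedges T \<Longrightarrow>
      (u \<in> uverts T - {r} \<and> \<pi> u = v) \<or> (v \<in> uverts T - {r} \<and> \<pi> v = u)"
    using tree_parent[OF T r] by metis
  have "finite (uverts T)" using sg by (simp add: simple_graph_def)
  from forest_dissociation[of "uverts T - {r}" d \<pi>, OF *(1) this]
  obtain U where U: "U \<subseteq> uverts T" "3 * card U \<le> card (uverts T)"
    "\<forall>x\<in>uverts T-U. \<forall>y\<in>uverts T-U. \<forall>z\<in>uverts T-U.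
      (x \<in> uverts T - {r} \<and> \<pi> x = y \<or> y \<in> uverts T - {r} \<and> \<pi> y = x) \<longrightarrow>
      (x \<in> uverts T - {r} \<and> \<pi> x = z \<or> z \<in> uverts T - {r} \<and> \<pi> z = x) \<longrightarrow> y = z"
    by blast
  have "y = z" if "x \<in> uverts T - U" "y \<in> uverts T - U" "z \<in> uverts T - U"
    "{x, y} \<in> uedges T" "{x, z} \<in> uedges T" for x y z
    using U(3) that(1-3) *(3)[OF that(4)] *(3)[OF that(5)] by blast
  then show thesis using that[of U] U(1,2) by blast
qed

section \<open>Leaves and degree sums\<close>

definition leaves :: "'a ugraph \<Rightarrow> 'a set" where
  "leaves G = {v \<in> uverts G. card (nbrs G v) = 1}"

lemma nbrs_subset: "simple_graph G \<Longrightarrow> nbrs G v \<subseteq> uverts G"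
  using simple_edge_verts by (fastforce simp: nbrs_def)

lemma finite_nbrs: "simple_graph G \<Longrightarrow> finite (nbrs G v)"
  by (rule finite_subset[OF nbrs_subset]) (simp_all add: simple_graph_def)

lemma card_nbrs:
  assumes "simple_graph G"
  shows "card (nbrs G v) = card {e \<in> uedges G. v \<in> e}"
proof -
  have "bij_betw (\<lambda>u. {v, u}) (nbrs G v) {e \<in> uedges G. v \<in> e}"
  proof (rule bij_betw_imageI)
    show "inj_on (\<lambda>u. {v, u}) (nbrs G v)"
      by (auto simp: inj_on_def doubleton_eq_iff)
    show "(\<lambda>u. {v, u}) ` nbrs G v = {e \<in> uedges G. v \<in> e}"
    proof (intro equalityI subsetI)
      fix e assume e: "e \<in> {e \<in> uedges G. v \<in> e}"
      then have "e \<in> uedges G" by simp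
      then obtain a b where "e = {a, b}" by (rule simple_edge_cases[OF assms])
      then show "e \<in> (\<lambda>u. {v, u}) ` nbrs G v"
        using e by (auto simp: nbrs_def insert_commute)
    qed (auto simp: nbrs_def)
  qed
  then show ?thesis by (rule bij_betw_same_card)
qed

lemma handshake:
  assumes "simple_graph G"
  shows "(\<Sum>v\<in>uverts G. card (nbrs G v)) = 2 * card (uedges G)"
  unfolding card_nbrs[OF assms]
proof (rule sum_multicount)
  show "\<forall>e\<in>uedges G. card {v \<in> uverts G. v \<in> e} = 2"
  proof
    fix e assume "e \<in> uedges G"
    then have "e \<subseteq> uverts G" "card e = 2" using assms by (auto simp: simple_graph_def)
    moreover from this have "{v \<in> uverts G. v \<in> e} = e" by auto
    ultimately show "card {v \<in> uverts G. v \<in> e} = 2" by simp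
  qed
qed (use assms finite_uedges in \<open>auto simp: simple_graph_def\<close>)

lemma connected_nbrs_nonempty:
  assumes "connected_graph G" "card (uverts G) \<ge> 2" "u \<in> uverts G"
  shows "nbrs G u \<noteq> {}"
proof -
  have "uverts G \<noteq> {u}" using assms(2) by auto
  then obtain v where v: "v \<in> uverts G" "u \<noteq> v" using assms(3) by blast
  obtain p where p: "graph_path G p" "hd p = u" "last p = v"
    using assms v by (auto simp: connected_graph_def)
  then obtain x q where "p = u # x # q"
    using v(2) by (cases p; cases "tl p") (auto simp: graph_path_def)
  then show ?thesis using p by (auto simp: graph_path_def adjacent_def nbrs_def)
qed

text \<open>
  The vertices outside \<open>S\<close> have degree at least 2 except for the leaves, so the degree sum
  over \<open>S\<close> is at most \<open>2 |S| + L - 2\<close>.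
\<close>

lemma tree_edges_avoiding:
  assumes T: "is_tree T" "card (uverts T) \<ge> 2" and S: "S \<subseteq> uverts T"
  shows "card (uverts T) + 1 \<le> card {e \<in> uedges T. e \<inter> S = {}} + card (leaves T) + 2 * card S"
proof -
  let ?V = "uverts T" and ?deg = "\<lambda>v. card (nbrs T v)"
  have sg: "simple_graph T" and conn: "connected_graph T"
    using T by (auto simp: is_tree_def)
  have fin: "finite ?V" "finite S" "finite (uedges T)"
    using sg S finite_subset finite_uedges by (auto simp: simple_graph_def)
  \<comment> \<open>An edge avoids \<open>S\<close> or is counted in the degree of some vertex of
    \<open>S\<close>.\<close>
  have "uedges T \<subseteq> {e \<in> uedges T. e \<inter> S = {}} \<union> (\<Union>s\<in>S. {e \<in> uedges T. s \<in> e})" by auto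
  then have "card (uedges T) \<le> card ({e \<in> uedges T. e \<inter> S = {}} \<union> (\<Union>s\<in>S. {e \<in> uedges T. s \<in> e}))"
    using fin by (intro card_mono) auto
  also have "\<dots> \<le> card {e \<in> uedges T. e \<inter> S = {}} + (\<Sum>s\<in>S. ?deg s)"
    unfolding card_nbrs[OF sg]
    by (rule order_trans[OF card_Un_le]) (use fin in \<open>simp add: card_UN_le\<close>)
  finally have 1: "card (uedges T) \<le> card {e \<in> uedges T. e \<inter> S = {}} + (\<Sum>s\<in>S. ?deg s)" .
  have 2: "(\<Sum>s\<in>S. ?deg s) + (\<Sum>v\<in>?V-S. ?deg v) = 2 * card (uedges T)"
    using handshake[OF sg] sum.subset_diff[OF S fin(1), of ?deg] by simp
  \<comment> \<open>The correction term raises the degree of a leaf to 2.\<close>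
  have "2 \<le> ?deg v + of_bool (v \<in> leaves T)" if v: "v \<in> ?V" for v
  proof -
    have "nbrs T v \<noteq> {}" using connected_nbrs_nonempty[OF conn T(2) v] .
    then have "?deg v \<noteq> 0"
      using finite_nbrs[OF sg] by simp
    then show ?thesis using v by (auto simp: leaves_def)
  qed
  then have "(\<Sum>v\<in>?V-S. 2) \<le> (\<Sum>v\<in>?V-S. ?deg v + of_bool (v \<in> leaves T))"
    by (intro sum_mono) auto
  also have "\<dots> = (\<Sum>v\<in>?V-S. ?deg v) + card ((?V - S) \<inter> leaves T)"
    using fin by (simp add: sum.distrib)
  also have "card ((?V - S) \<inter> leaves T) \<le> card (leaves T)"
    using fin by (intro card_mono) (auto simp: leaves_def)
  finally have "2 * card (?V - S) \<le> (\<Sum>v\<in>?V-S. ?deg v) + card (leaves T)" by simp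
  moreover have "card (?V - S) = card ?V - card S" "card S \<le> card ?V"
    using fin S by (auto simp: card_Diff_subset card_mono)
  ultimately show ?thesis using 1 2 tree_card_edges[OF T(1)] by linarith
qed

text \<open>If no path has five vertices, none has four either, as \<open>T\<close> is not a double
  star. Distinct vertices then have distance at most 2, which makes \<open>T\<close> a star around
  the middle of any path on three vertices.\<close>

lemma path5_exists:
  assumes T: "is_tree T" "\<not> is_star T" "\<not> is_double_star T"
  obtains a b c d e where "graph_path T [a, b, c, d, e]"
proof -
  have conn: "connected_graph T" using T by (simp add: is_tree_def)
  have short: "length p \<le> 3" if no5: "\<nexists>p. graph_path T p \<and> length p \<ge> 5" and p: "graph_path T p" for p
  proof -
    have "\<forall>p. graph_path T p \<longrightarrow> length p \<le> 4" using no5 by (metis not_less_eq_eq numeral_eq_Suc pred_numeral_simps)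
    then have "length p \<noteq> 4" "length p \<le> 4" using T(1,3) p by (auto simp: is_double_star_def)
    then show ?thesis by simp
  qed
  have ex: "\<exists>p. graph_path T p \<and> hd p = u \<and> last p = v" if "u \<in> uverts T" "v \<in> uverts T" for u v
    using conn that by (auto simp: connected_graph_def)
  have "\<exists>p. graph_path T p \<and> length p \<ge> 5"
  proof (rule ccontr)
    assume no5: "\<nexists>p. graph_path T p \<and> length p \<ge> 5"
    note short = short[OF no5]
    have shape: "adjacent T u v \<or> (\<exists>w. graph_path T [u, w, v])"
      if uv: "u \<in> uverts T" "v \<in> uverts T" "u \<noteq> v" for u v
    proof -
      obtain p where p: "graph_path T p" "hd p = u" "last p = v" using ex uv by blast
      then have "p \<noteq> []" "length p \<le> 3" using short by (auto simp: graph_path_def)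
      then obtain x y z where "p = [x] \<or> p = [x, y] \<or> p = [x, y, z]"
        by (cases p; cases "tl p"; cases "tl (tl p)") auto
      then show ?thesis using p uv by (auto simp: graph_path_def)
    qed
    have "\<exists>c\<in>uverts T. \<forall>v\<in>uverts T - {c}. adjacent T c v"
    proof (cases "\<exists>a c b. graph_path T [a, c, b]")
      case False
      obtain c where "c \<in> uverts T" using conn by (auto simp: connected_graph_def)
      then show ?thesis using shape False by blast
    next
      case True
      then obtain a c b where acb: "graph_path T [a, c, b]" by blast
      have "adjacent T c v" if v: "v \<in> uverts T - {c}" for v
      proof (rule ccontr)
        assume na: "\<not> adjacent T c v"
        then have "v \<noteq> a" "v \<noteq> b"
          using acb adjacent_commute[of T a c] by (auto simp: graph_path_def)
        obtain w where w: "graph_path T [v, w, c]"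
          using shape[of v c] v acb na adjacent_commute[of T v c] by (auto simp: graph_path_def)
        \<comment> \<open>An end of \<open>[a, c, b]\<close> other than \<open>w\<close>, so that
          \<open>[v, w, c, x]\<close> repeats no vertex.\<close>
        define x where "x = (if w = a then b else a)"
        have "graph_path T [v, w, c, x]"
          using w acb \<open>v \<noteq> a\<close> \<open>v \<noteq> b\<close> adjacent_commute[of T a c]
          by (auto simp: graph_path_def x_def)
        then show False using short by fastforce
      qed
      then show ?thesis using acb by (auto simp: graph_path_def)
    qed
    then show False using T by (simp add: is_star_def)
  qed
  then obtain p where p: "graph_path T p" "length p \<ge> 5" by blast
  then obtain a b c d e q where "p = [a, b, c, d, e] @ q"
    by (auto simp: numeral_eq_Suc Suc_le_length_iff)
  then show thesis using p graph_path_appendD1 that by blast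
qed

subsection \<open>The three constructions\<close>

text \<open>Common frame of the three constructions: it remains to choose \<open>W\<close> with
  enough classes under \<open>\<rho>\<close> and, for each \<open>N\<close>, a matching
  \<open>Z N\<close> that contains two edges of every copy of \<open>T\<close>.\<close>

lemma bigomega_of_hitting:
  fixes T :: "'a ugraph" and \<rho> :: "'a \<Rightarrow> 'b"
  assumes T: "is_tree T" "card (uverts T) \<ge> 2" and W: "W \<subseteq> uverts T"
    and \<rho>: "\<And>u v. u \<in> W \<Longrightarrow> v \<in> W \<Longrightarrow> {u, v} \<in> uedges T \<Longrightarrow> \<rho> u = \<rho> v"
    and many: "card (uverts T) \<le> 4 * card (\<rho> ` W)"
    and Z: "\<And>N e f. e \<in> Z N \<Longrightarrow> f \<in> Z N \<Longrightarrow> e \<noteq> f \<Longrightarrow> e \<inter> f = {}"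
    and hit: "\<And>N f. embedding T (blowup T W N) f \<Longrightarrow>
      \<exists>a\<in>uedges T. \<exists>b\<in>uedges T. a \<noteq> b \<and> f ` a \<in> Z N \<and> f ` b \<in> Z N"
  shows "(\<lambda>n. real (rainbow_ex n T T)) \<in> \<Omega>(\<lambda>n. real n ^ nat \<lceil>real (card (uverts T)) / 4\<rceil>)"
proof (rule bigomega_of_blowup)
  have sg: "simple_graph T" and conn: "connected_graph T"
    using T by (auto simp: is_tree_def)
  have covered: "uverts T \<subseteq> \<Union>(uedges T)"
  proof
    fix v assume v: "v \<in> uverts T"
    have "nbrs T v \<noteq> {}" using connected_nbrs_nonempty[OF conn T(2) v] .
    then show "v \<in> \<Union>(uedges T)" by (auto simp: nbrs_def)
  qed
  show "1 \<le> card (uverts T)" using T(2) by simp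
  show "card (uverts T) \<le> 4 * card (\<rho> ` W)" by (rule many)
  fix n N :: nat
  assume N: "1 \<le> N" "card (uverts T) * N \<le> n"
  have "N ^ card (\<rho> ` W) \<le> card (copies T (blowup T W N))"
    by (rule card_copies_blowup[OF sg W \<rho>])
  also have "\<dots> \<le> rainbow_ex n T T"
  proof (rule rainbow_ex_ge[OF sg covered simple_blowup[OF sg]])
    show "card (uverts (blowup T W N)) \<le> n" using card_blowup[OF sg N(1), of W] N(2) by linarith
    show "e \<inter> f = {}" if "e \<in> Z N" "f \<in> Z N" "e \<noteq> f" for e f using Z that by blast
    show "\<exists>a\<in>uedges T. \<exists>b\<in>uedges T. a \<noteq> b \<and> f ` a \<in> Z N \<and> f ` b \<in> Z N"
      if "embedding T (blowup T W N) f" for f using hit[OF that] .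
  qed
  finally show "N ^ card (\<rho> ` W) \<le> rainbow_ex n T T" .
qed

text \<open>The first coordinate of an embedding into a blow-up is a homomorphism from
  \<open>T\<close> to itself, in general not an injective one.\<close>

lemma embedding_blowup_edge:
  assumes "embedding T (blowup T W N) f" "{x, y} \<in> uedges T"
  shows "{fst (f x), fst (f y)} \<in> uedges T" "snd (f x) \<in> slots W N (fst (f x))"
    "fst (f x) \<in> W \<Longrightarrow> fst (f y) \<in> W \<Longrightarrow> snd (f x) = snd (f y)"
proof -
  have "f ` {x, y} \<in> uedges (blowup T W N)" using assms by (simp only: embedding_def)
  then have "{(fst (f x), snd (f x)), (fst (f y), snd (f y))} \<in> uedges (blowup T W N)" by simp
  from this[unfolded blowup_edge_iff]
  show "{fst (f x), fst (f y)} \<in> uedges T" "snd (f x) \<in> slots W N (fst (f x))"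
    "fst (f x) \<in> W \<Longrightarrow> fst (f y) \<in> W \<Longrightarrow> snd (f x) = snd (f y)" by blast+
qed

lemma two_of_card_ge_2:
  assumes "card A \<ge> 2"
  obtains a b where "a \<in> A" "b \<in> A" "a \<noteq> b"
proof -
  have "finite A" using assms by (cases "finite A") auto
  have "\<not> card A \<le> Suc 0" using assms by simp
  then show thesis using card_le_Suc0_iff_eq[OF \<open>finite A\<close>] that by blast
qed

text \<open>At least two thirds of the vertices lie outside \<open>U\<close>, in components of size
  at most 2, so there are at least \<open>t / 3\<close> components. By \<open>few\<close>,
  \<open>tree_edges_avoiding\<close> yields two edges off any set of at most \<open>t div 3\<close>
  vertices.\<close>

lemma few_leaves:
  fixes T :: "'a ugraph"
  assumes T: "is_tree T" "card (uverts T) \<ge> 2"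
    and few: "card (leaves T) + 1 + 2 * (card (uverts T) div 3) \<le> card (uverts T)"
  shows "(\<lambda>n. real (rainbow_ex n T T)) \<in> \<Omega>(\<lambda>n. real n ^ nat \<lceil>real (card (uverts T)) / 4\<rceil>)"
proof -
  let ?V = "uverts T"
  obtain U where U: "U \<subseteq> ?V" "3 * card U \<le> card ?V"
    "\<And>x y z. x \<in> ?V - U \<Longrightarrow> y \<in> ?V - U \<Longrightarrow> z \<in> ?V - U \<Longrightarrow>
      {x, y} \<in> uedges T \<Longrightarrow> {x, z} \<in> uedges T \<Longrightarrow> y = z"
    using tree_dissociation[OF T(1)] by blast
  have sg: "simple_graph T" and conn: "connected_graph T"
    using T by (auto simp: is_tree_def)
  have fin: "finite ?V" "finite U" using sg U(1) finite_subset by (auto simp: simple_graph_def)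
  define W where "W = ?V - U"
  \<comment> \<open>\<open>\<rho> w\<close> is the vertex set of the component of \<open>w\<close>
    in \<open>T[W]\<close>.\<close>
  define \<rho> where "\<rho> w = insert w (nbrs T w \<inter> W)" for w
  define Z where "Z N = {e \<in> uedges (blowup T W N). fst ` e \<subseteq> W}" for N
  have match: "y = z" if "x \<in> W" "y \<in> W" "z \<in> W" "{x, y} \<in> uedges T" "{x, z} \<in> uedges T" for x y z
    using U(3) that unfolding W_def by blast
  have \<rho>_edge: "\<rho> u = {u, v}" if "u \<in> W" "v \<in> W" "{u, v} \<in> uedges T" for u v
  proof -
    have "nbrs T u \<inter> W = {v}" using match[OF that(1) _ that(2) _ that(3)] that unfolding nbrs_def by blast
    then show ?thesis by (simp add: \<rho>_def)
  qed
  have finW: "finite W" using fin by (simp add: W_def)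
  have \<rho>_card: "card (\<rho> w) \<le> 2" if "w \<in> W" for w
  proof (cases "nbrs T w \<inter> W = {}")
    case True
    then show ?thesis by (simp add: \<rho>_def)
  next
    case False
    then obtain v where "v \<in> W" "{w, v} \<in> uedges T" by (auto simp: nbrs_def)
    then show ?thesis using \<rho>_edge that by (simp add: card_insert_if)
  qed
  have "W = (\<Union>s\<in>\<rho> ` W. s)" by (auto simp: \<rho>_def)
  then have "card W \<le> (\<Sum>s\<in>\<rho> ` W. card s)" using finW card_UN_le[of "\<rho> ` W" "\<lambda>s. s"] by simp
  also have "\<dots> \<le> (\<Sum>s\<in>\<rho> ` W. 2)" using \<rho>_card by (intro sum_mono) auto
  finally have cW: "card W \<le> 2 * card (\<rho> ` W)" by simp
  have "card W = card ?V - card U" using fin U by (simp add: W_def card_Diff_subset)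
  show ?thesis
  proof (rule bigomega_of_hitting[OF T, of W \<rho> Z])
    show "W \<subseteq> ?V" by (auto simp: W_def)
    show "\<rho> u = \<rho> v" if "u \<in> W" "v \<in> W" "{u, v} \<in> uedges T" for u v
      using \<rho>_edge[OF that] \<rho>_edge[of v u] that by (simp add: insert_commute)
    show "card ?V \<le> 4 * card (\<rho> ` W)"
      using cW \<open>card W = card ?V - card U\<close> U(2) by linarith
  next
    fix N e f assume ef: "e \<in> Z N" "f \<in> Z N" "e \<noteq> f"
    \<comment> \<open>Both ends of an edge of \<open>Z N\<close> have the same index, so by
      \<open>match\<close> at most one such edge passes through \<open>(x, i)\<close>.\<close>
    have rep: "\<exists>y. {x, y} \<in> uedges T \<and> x \<in> W \<and> y \<in> W \<and> g = {(x, i), (y, i)}"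
      if "g \<in> Z N" "(x, i) \<in> g" for g x i
    proof -
      have "g \<in> uedges (blowup T W N)" using that(1) by (simp add: Z_def)
      then obtain p q where pq: "g = {p, q}"
        using simple_edge_cases[OF simple_blowup[OF sg]] by metis
      define r where "r = (if p = (x, i) then q else p)"
      have "g = {(x, i), r}" using pq that(2) by (auto simp: r_def)
      then obtain y j where g: "g = {(x, i), (y, j)}" by (metis prod.collapse)
      have W: "x \<in> W" "y \<in> W" using that(1) unfolding Z_def g by auto
      have "{(x, i), (y, j)} \<in> uedges (blowup T W N)" using that(1) unfolding Z_def g by auto
      then have "{x, y} \<in> uedges T" "i = j" using W unfolding blowup_edge_iff by auto
      then show ?thesis using g W by blast
    qed
    show "e \<inter> f = {}"
    proof (rule ccontr)
      assume "e \<inter> f \<noteq> {}"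
      then obtain x i where x: "(x, i) \<in> e" "(x, i) \<in> f" by auto
      obtain y where y: "{x, y} \<in> uedges T" "x \<in> W" "y \<in> W" "e = {(x, i), (y, i)}"
        using rep[OF ef(1) x(1)] by blast
      obtain z where z: "{x, z} \<in> uedges T" "z \<in> W" "f = {(x, i), (z, i)}"
        using rep[OF ef(2) x(2)] by blast
      have "y = z" using match y z by blast
      then show False using y z ef by simp
    qed
  next
    fix N and f :: "'a \<Rightarrow> 'a \<times> nat"
    assume f: "embedding T (blowup T W N) f"
    \<comment> \<open>At most \<open>|U|\<close> vertices of \<open>T\<close> are mapped to \<open>U\<close>, and an edge avoiding them lands in \<open>Z\<close>.\<close>
    define S where "S = {x \<in> ?V. fst (f x) \<in> U}"
    \<comment> \<open>Vertices of \<open>U\<close> are not blown up, so only index 0 occurs over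
      them.\<close>
    have "f x \<in> U \<times> {0}" if "x \<in> S" for x
    proof -
      have x: "x \<in> ?V" "fst (f x) \<in> U" using that by (auto simp: S_def)
      then obtain y where "{x, y} \<in> uedges T"
        using connected_nbrs_nonempty[OF conn T(2) x(1)] by (auto simp: nbrs_def)
      then have "snd (f x) \<in> slots W N (fst (f x))" using embedding_blowup_edge(2)[OF f] by blast
      then show ?thesis using x by (auto simp: slots_def W_def mem_Times_iff)
    qed
    then have "f ` S \<subseteq> U \<times> {0}" by blast
    moreover have "inj_on f S" using f by (auto simp: embedding_def S_def inj_on_def)
    ultimately have "card S \<le> card (U \<times> {0::nat})"
      using fin by (intro card_inj_on_le[of f]) auto
    then have "card S \<le> card U" by (simp add: card_cartesian_product)
    then have "card S \<le> card ?V div 3" using U(2) by linarith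
    moreover have "S \<subseteq> ?V" by (auto simp: S_def)
    ultimately have "card {e \<in> uedges T. e \<inter> S = {}} \<ge> 2"
      using tree_edges_avoiding[OF T \<open>S \<subseteq> ?V\<close>] few by linarith
    then obtain a b where ab: "a \<in> {e \<in> uedges T. e \<inter> S = {}}" "b \<in> {e \<in> uedges T. e \<inter> S = {}}"
      "a \<noteq> b" by (rule two_of_card_ge_2)
    have "f ` e \<in> Z N" if e: "e \<in> uedges T" "e \<inter> S = {}" for e
    proof -
      have fe: "f ` e \<in> uedges (blowup T W N)" using f e by (simp add: embedding_def)
      moreover have "fst (f x) \<in> W" if "x \<in> e" for x
      proof -
        have "x \<in> ?V" using e(1) \<open>x \<in> e\<close> sg by (auto simp: simple_graph_def)
        moreover have "f ` e \<subseteq> uverts (blowup T W N)"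
          using fe simple_blowup[OF sg, of W N] by (simp add: simple_graph_def)
        then have "f x \<in> uverts (blowup T W N)" using \<open>x \<in> e\<close> by blast
        then have "fst (f x) \<in> ?V" by (auto simp: blowup_def)
        ultimately show ?thesis using e(2) \<open>x \<in> e\<close> by (auto simp: W_def S_def)
      qed
      ultimately show ?thesis by (simp add: Z_def image_subset_iff)
    qed
    then show "\<exists>a\<in>uedges T. \<exists>b\<in>uedges T. a \<noteq> b \<and> f ` a \<in> Z N \<and> f ` b \<in> Z N"
      using ab by blast
  qed
qed

section \<open>Embeddings into blow-ups of leaves\<close>

lemma leaf_nbrs:
  assumes "u \<in> leaves T" "{u, v} \<in> uedges T"
  shows "nbrs T u = {v}"
proof -
  have "card (nbrs T u) = 1" "v \<in> nbrs T u" using assms by (auto simp: leaves_def nbrs_def)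
  then show ?thesis by (metis card_1_singletonE singletonD)
qed

text \<open>Two adjacent leaves form a whole component, so no path would lead from them to the
  non-leaf \<open>x\<close>.\<close>

lemma leaf_nbr_not_leaf:
  assumes conn: "connected_graph T" "simple_graph T" and u: "u \<in> leaves T" and uv: "{u, v} \<in> uedges T"
    and x: "x \<in> uverts T" "x \<notin> leaves T"
  shows "v \<notin> leaves T"
proof
  assume v: "v \<in> leaves T"
  have V: "u \<in> uverts T" using u by (simp add: leaves_def)
  obtain p where p: "graph_path T p" "hd p = u" "last p = x"
    using conn(1) V x by (auto simp: connected_graph_def)
  have nb: "nbrs T u = {v}" "nbrs T v = {u}"
    using leaf_nbrs[OF u uv] leaf_nbrs[of v T u] v uv by (simp_all add: insert_commute)
  have "u \<noteq> x" "v \<noteq> x" using u v x by auto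
  obtain q where q: "p = u # q" using p by (cases p) (auto simp: graph_path_def)
  then obtain y r where y: "q = y # r" using p \<open>u \<noteq> x\<close> by (cases q) auto
  then have "y \<in> nbrs T u" using p q by (auto simp: graph_path_def adjacent_def nbrs_def)
  then have "y = v" using nb by simp
  then obtain z s where "r = z # s" using p q y \<open>v \<noteq> x\<close> by (cases r) auto
  then have "z \<in> nbrs T v" "z \<noteq> u"
    using p q y \<open>y = v\<close> by (auto simp: graph_path_def adjacent_def nbrs_def)
  then show False using nb by simp
qed

context
  fixes T :: "'a ugraph" and W :: "'a set" and N :: nat and f :: "'a \<Rightarrow> 'a \<times> nat"
  assumes T: "is_tree T" "card (uverts T) \<ge> 2" and W: "W \<subseteq> leaves T"
    and f: "embedding T (blowup T W N) f"
begin

text \<open>A non-leaf has two neighbors. If it were sent to a copy of a leaf, both would go to the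
  only neighbor of that leaf, a non-leaf with a single copy, against injectivity.\<close>

lemma embedding_inner:
  assumes x: "x \<in> uverts T" "x \<notin> leaves T"
  shows "fst (f x) \<in> uverts T - leaves T" "snd (f x) = 0"
proof -
  have sg: "simple_graph T" and conn: "connected_graph T" using T by (auto simp: is_tree_def)
  have "nbrs T x \<noteq> {}" using connected_nbrs_nonempty[OF conn T(2) x(1)] .
  then have "card (nbrs T x) \<noteq> 0" using finite_nbrs[OF sg] by simp
  moreover have "card (nbrs T x) \<noteq> 1" using x by (simp add: leaves_def)
  ultimately have "card (nbrs T x) \<ge> 2" by linarith
  then obtain y z where yz: "y \<in> nbrs T x" "z \<in> nbrs T x" "y \<noteq> z" by (rule two_of_card_ge_2)
  have e: "{x, y} \<in> uedges T" "{x, z} \<in> uedges T" using yz by (auto simp: nbrs_def)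
  note fe = embedding_blowup_edge[OF f]
  have V: "fst (f x) \<in> uverts T" using simple_edge_verts[OF sg fe(1)[OF e(1)]] by blast
  show nl: "fst (f x) \<in> uverts T - leaves T"
  proof (rule ccontr)
    assume "\<not> ?thesis"
    then have l: "fst (f x) \<in> leaves T" using V by blast
    have only: "u = v" if "{fst (f x), u} \<in> uedges T" "{fst (f x), v} \<in> uedges T" for u v
      using leaf_nbrs[OF l that(1)] leaf_nbrs[OF l that(2)] by simp
    then have same: "fst (f y) = fst (f z)" using fe(1) e by blast
    have "fst (f y) \<notin> leaves T"
      by (rule leaf_nbr_not_leaf[OF conn sg l fe(1)[OF e(1)] x])
    then have "fst (f y) \<notin> W" "fst (f z) \<notin> W" using W same by auto
    moreover have "snd (f y) \<in> slots W N (fst (f y))" "snd (f z) \<in> slots W N (fst (f z))"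
      using fe(2)[of y x] fe(2)[of z x] e by (simp_all add: insert_commute)
    ultimately have "f y = f z" using same by (simp add: prod_eq_iff slots_def)
    moreover have "y \<in> uverts T" "z \<in> uverts T" using yz nbrs_subset[OF sg] by blast+
    ultimately show False using f yz(3) by (auto simp: embedding_def inj_on_def)
  qed
  then have "fst (f x) \<notin> W" using W by blast
  then show "snd (f x) = 0" using fe(2)[OF e(1)] by (simp add: slots_def)
qed

text \<open>Non-leaves are sent to index 0, so first coordinates determine their images.\<close>

lemma embedding_inner_inj:
  "inj_on (fst \<circ> f) (uverts T - leaves T)"
proof (rule inj_onI)
  fix x y assume xy: "x \<in> uverts T - leaves T" "y \<in> uverts T - leaves T" "(fst \<circ> f) x = (fst \<circ> f) y"
  then have "f x = f y" using embedding_inner[of x] embedding_inner[of y] by (simp add: prod_eq_iff)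
  then show "x = y" using f xy by (auto simp: embedding_def inj_on_def)
qed

lemma embedding_inner_surj:
  "(fst \<circ> f) ` (uverts T - leaves T) = uverts T - leaves T"
proof (rule endo_inj_surj)
  show "finite (uverts T - leaves T)" using T by (simp add: is_tree_def simple_graph_def)
  show "(fst \<circ> f) ` (uverts T - leaves T) \<subseteq> uverts T - leaves T"
    using embedding_inner(1) by auto
qed (rule embedding_inner_inj)

text \<open>The permutation of the non-leaves maps the finite set of edges between non-leaves
  injectively into itself, hence onto itself: every copy of \<open>T\<close> uses all of these edges
  at index 0.\<close>

lemma embedding_inner_edge:
  assumes e: "e \<in> uedges T" "e \<inter> leaves T = {}"
  shows "\<exists>a\<in>uedges T. f ` a = (\<lambda>v. (v, 0)) ` e"
proof -
  let ?E = "{e \<in> uedges T. e \<inter> leaves T = {}}" and ?I = "uverts T - leaves T"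
  have sg: "simple_graph T" using T by (simp add: is_tree_def)
  have EI: "e \<subseteq> ?I" if "e \<in> ?E" for e using that sg by (auto simp: simple_graph_def)
  have surj: "(\<lambda>e. (fst \<circ> f) ` e) ` ?E = ?E"
  proof (rule endo_inj_surj)
    show "finite ?E" using finite_uedges[OF sg] by simp
    show "(\<lambda>e. (fst \<circ> f) ` e) ` ?E \<subseteq> ?E"
    proof (rule image_subsetI)
      fix e assume e: "e \<in> ?E"
      then have "e \<in> uedges T" by simp
      then obtain u v where uv: "e = {u, v}" by (rule simple_edge_cases[OF sg])
      then have "{fst (f u), fst (f v)} \<in> uedges T"
        using embedding_blowup_edge(1)[OF f] e by simp
      moreover have "fst (f u) \<notin> leaves T" "fst (f v) \<notin> leaves T"
        using embedding_inner(1) EI[OF e] uv by auto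
      ultimately show "(fst \<circ> f) ` e \<in> ?E" using uv by simp
    qed
    show "inj_on (\<lambda>e. (fst \<circ> f) ` e) ?E"
    proof (rule inj_onI)
      fix a b assume ab: "a \<in> ?E" "b \<in> ?E" "(fst \<circ> f) ` a = (fst \<circ> f) ` b"
      then show "a = b"
        using inj_on_image_eq_iff[OF embedding_inner_inj EI[OF ab(1)] EI[OF ab(2)]] by simp
    qed
  qed
  have "e \<in> (\<lambda>e. (fst \<circ> f) ` e) ` ?E" unfolding surj using e by simp
  then obtain a where a: "a \<in> ?E" "e = (fst \<circ> f) ` a" by (rule imageE)
  have "f x = (fst (f x), 0)" if "x \<in> a" for x
  proof -
    have "x \<in> ?I" using EI[OF a(1)] that by blast
    then show ?thesis using embedding_inner(2)[of x] by (simp add: prod_eq_iff)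
  qed
  then have "f ` a = (\<lambda>x. (fst (f x), 0)) ` a" by (rule image_cong[OF refl])
  also have "\<dots> = (\<lambda>v. (v, 0)) ` e" unfolding a(2) image_image comp_def ..
  finally show ?thesis using a(1) by blast
qed

end

text \<open>Every copy of \<open>T\<close> contains both edges by
  \<open>embedding_inner_edge\<close>; being disjoint, they may share a color.\<close>

lemma disjoint_inner_edges:
  fixes T :: "'a ugraph"
  assumes T: "is_tree T" "card (uverts T) \<ge> 2"
    and many: "card (uverts T) \<le> 4 * card (leaves T)"
    and e: "e1 \<in> uedges T" "e2 \<in> uedges T" "e1 \<inter> leaves T = {}" "e2 \<inter> leaves T = {}" "e1 \<inter> e2 = {}"
  shows "(\<lambda>n. real (rainbow_ex n T T)) \<in> \<Omega>(\<lambda>n. real n ^ nat \<lceil>real (card (uverts T)) / 4\<rceil>)"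
proof -
  have sg: "simple_graph T" and conn: "connected_graph T"
    using T by (auto simp: is_tree_def)
  obtain x y where "e1 = {x, y}" "x \<in> uverts T" using simple_edge_cases[OF sg e(1)] by metis
  then have x: "x \<in> uverts T" "x \<notin> leaves T" using e(3) by auto
  have ne: "e1 \<noteq> {}" using sg e(1) by (auto simp: simple_graph_def)
  let ?Z = "\<lambda>_::nat. {(\<lambda>v. (v, 0::nat)) ` e1, (\<lambda>v. (v, 0)) ` e2}"
  show ?thesis
  proof (rule bigomega_of_hitting[OF T, of "leaves T" id ?Z])
    show "leaves T \<subseteq> uverts T" by (auto simp: leaves_def)
    \<comment> \<open>No two leaves are adjacent, so each leaf is a class of its own.\<close>
    show "id u = id v" if "u \<in> leaves T" "v \<in> leaves T" "{u, v} \<in> uedges T" for u v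
      using leaf_nbr_not_leaf[OF conn sg that(1,3) x] that(2) by blast
    show "card (uverts T) \<le> 4 * card (id ` leaves T)" using many by simp
    show "a \<inter> b = {}" if "a \<in> ?Z N" "b \<in> ?Z N" "a \<noteq> b" for N a b
      using that e(5) by auto
    show "\<exists>a\<in>uedges T. \<exists>b\<in>uedges T. a \<noteq> b \<and> f ` a \<in> ?Z N \<and> f ` b \<in> ?Z N"
      if f: "embedding T (blowup T (leaves T) N) f" for N f
    proof -
      obtain a where a: "a \<in> uedges T" "f ` a = (\<lambda>v. (v, 0)) ` e1"
        using embedding_inner_edge[OF T subset_refl f e(1,3)] by (rule bexE)
      obtain b where b: "b \<in> uedges T" "f ` b = (\<lambda>v. (v, 0)) ` e2"
        using embedding_inner_edge[OF T subset_refl f e(2,4)] by (rule bexE)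
      have ne_ab: "a \<noteq> b"
      proof
        assume "a = b"
        then have "(\<lambda>v. (v, 0::nat)) ` e1 = (\<lambda>v. (v, 0)) ` e2" using a(2) b(2) by simp
        then have "fst ` (\<lambda>v. (v, 0::nat)) ` e1 = fst ` (\<lambda>v. (v, 0::nat)) ` e2" by simp
        then have "e1 = e2" unfolding image_image by simp
        then show False using ne e(5) by simp
      qed
      have "f ` a \<in> ?Z N" "f ` b \<in> ?Z N" using a(2) b(2) by simp_all
      then show ?thesis using ne_ab a(1) b(1) by (intro bexI[of _ a] bexI[of _ b] conjI)
    qed
  qed
qed

text \<open>
  Blow up all leaves except those at a vertex \<open>w\<close> with the fewest leaves.  An embedding permutes
  the non-leaves fixing the center \<open>v\<close>; the vertex sent to \<open>w\<close> has at least the degree of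
  \<open>w\<close>, so all edges at \<open>w\<close> are used, in particular a leaf edge colored like \<open>va\<close>.
\<close>

lemma inner_star:
  fixes T :: "'a ugraph" and v :: 'a
  defines "I \<equiv> uverts T - leaves T"
  assumes T: "is_tree T" "card (uverts T) \<ge> 2"
    and v: "v \<in> I"
    and star: "\<And>x. x \<in> I - {v} \<Longrightarrow> nbrs T x \<inter> I = {v}"
    and card_I: "card I \<ge> 3"
    and not_P5: "\<not> (card (uverts T) = 5 \<and> card (leaves T) = 2)"
  shows "(\<lambda>n. real (rainbow_ex n T T)) \<in> \<Omega>(\<lambda>n. real n ^ nat \<lceil>real (card (uverts T)) / 4\<rceil>)"
proof -
  let ?V = "uverts T" and ?L = "leaves T"
  have sg: "simple_graph T" and conn: "connected_graph T"
    using T by (auto simp: is_tree_def)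
  have fin: "finite ?V" "finite I" "finite ?L"
    using sg by (auto simp: simple_graph_def I_def leaves_def)
  have v': "v \<in> ?V" "v \<notin> ?L" using v by (auto simp: I_def)
  define J where "J = I - {v}"
  define B where "B x = nbrs T x \<inter> ?L" for x
  define p where "p x = card (B x)" for x
  have cardJ: "card I = Suc (card J)" "finite J"
    using v fin card_Suc_Diff1[of I v] by (simp_all add: J_def)
  have finB: "finite (B x)" for x using fin by (simp add: B_def)
  have nbJ: "nbrs T x = insert v (B x)" if "x \<in> J" for x
    using star[of x] that nbrs_subset[OF sg, of x] by (auto simp: J_def B_def I_def)
  have cardn: "card (nbrs T x) = Suc (p x)" if "x \<in> J" for x
  proof -
    have "v \<notin> B x" using v' by (simp add: B_def)
    then show ?thesis using nbJ[OF that] finB[of x] by (simp add: p_def)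
  qed
  have p_pos: "p x \<ge> 1" if "x \<in> J" for x
  proof -
    have "card (nbrs T x) \<noteq> 1" using that by (auto simp: J_def I_def leaves_def)
    then show ?thesis using cardn[OF that] by simp
  qed
  have "J \<noteq> {}" using cardJ card_I by auto
  then have "Min (p ` J) \<in> p ` J" using cardJ by (intro Min_in) auto
  then obtain w where "w \<in> J" "p w = Min (p ` J)" by auto
  then have w: "w \<in> J" "\<And>x. x \<in> J \<Longrightarrow> p w \<le> p x" using cardJ by simp_all
  have B_inj: "x = y" if "l \<in> B x" "l \<in> B y" for x y l
  proof -
    have l: "l \<in> ?L" "{l, x} \<in> uedges T" "{l, y} \<in> uedges T"
      using that by (auto simp: B_def nbrs_def insert_commute)
    show ?thesis using leaf_nbrs[OF l(1,2)] leaf_nbrs[OF l(1,3)] by simp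
  qed
  \<comment> \<open>The leaves at \<open>w\<close> keep single copies; otherwise a copy of
    \<open>T\<close> could avoid the edge \<open>{w, l}\<close> below by using another copy of
    \<open>l\<close>.\<close>
  define W where "W = ?L - B w"
  have WL: "W \<subseteq> ?L" by (auto simp: W_def)
  have cardL: "card ?L = card W + p w"
  proof -
    have "B w \<subseteq> ?L" by (auto simp: B_def)
    then show ?thesis
      using card_Diff_subset[OF finB] card_mono[OF fin(3)] unfolding W_def p_def by simp
  qed
  have cardV: "card ?V = card ?L + Suc (card J)"
  proof -
    have "?L \<subseteq> ?V" by (auto simp: leaves_def)
    then have "card I = card ?V - card ?L" "card ?L \<le> card ?V"
      using fin by (simp_all add: I_def card_Diff_subset card_mono)
    then show ?thesis using cardJ by simp
  qed
  \<comment> \<open>The leaves at the other vertices of \<open>J\<close> stay in \<open>W\<close>;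
    these sets are disjoint and have at least \<open>p w\<close> elements each.\<close>
  have "(\<Union>x\<in>J - {w}. B x) \<subseteq> W" using B_inj by (auto simp: W_def) (auto simp: B_def)
  then have "card (\<Union>x\<in>J - {w}. B x) \<le> card W"
    using fin by (intro card_mono) (simp_all add: W_def)
  moreover have "card (\<Union>x\<in>J - {w}. B x) = (\<Sum>x\<in>J - {w}. p x)"
    unfolding p_def using cardJ finB B_inj by (intro card_UN_disjoint) auto
  moreover have "(\<Sum>x\<in>J - {w}. p w) \<le> (\<Sum>x\<in>J - {w}. p x)"
    using w by (intro sum_mono) auto
  ultimately have W_ge: "(card J - 1) * p w \<le> card W"
    using w(1) cardJ by simp
  have bound: "card ?V \<le> 4 * card W"
  proof -
    obtain j q where jq: "card J = j + 2" "p w = q + 1"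
      using that[of "card J - 2" "p w - 1"] cardJ card_I p_pos[OF w(1)] by simp
    have "(j + 1) * (q + 1) = j * q + j + q + 1" by (simp add: algebra_simps)
    then have "j + q + 1 \<le> card W" using W_ge jq by simp
    \<comment> \<open>This case would give five vertices and two leaves. In all other cases
      \<open>3 * card W \<ge> j + q + 4\<close>, which is the claim.\<close>
    moreover have "\<not> (j = 0 \<and> q = 0 \<and> card W = 1)" using not_P5 cardV cardL jq by auto
    ultimately show ?thesis using cardV cardL jq by linarith
  qed
  obtain a where a: "a \<in> J" "a \<noteq> w"
  proof -
    have "card J \<ge> 2" using cardJ card_I by simp
    then obtain x y where "x \<in> J" "y \<in> J" "x \<noteq> y" by (rule two_of_card_ge_2)
    then show thesis using that by metis
  qed
  have va: "{v, a} \<in> uedges T"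
    using nbJ[OF a(1)] by (auto simp: nbrs_def insert_commute)
  have "B w \<noteq> {}" using p_pos[OF w(1)] by (auto simp: p_def)
  then obtain l where l: "l \<in> B w" by blast
  have J_nl: "x \<in> ?V" "x \<notin> ?L" if "x \<in> J" for x using that by (auto simp: J_def I_def)
  have vJ: "v \<notin> J" by (simp add: J_def)
  have lL: "l \<in> ?L" using l by (simp add: B_def)
  have lw: "{w, l} \<in> uedges T" using l by (simp add: B_def nbrs_def)
  let ?\<iota> = "\<lambda>u. (u, 0::nat)"
  let ?Z = "\<lambda>_::nat. {?\<iota> ` {v, a}, ?\<iota> ` {w, l}}"
  have disj: "{v, a} \<inter> {w, l} = {}"
    using a w(1) vJ lL v' J_nl(2)[OF a(1)] by auto
  show ?thesis
  proof (rule bigomega_of_hitting[OF T, of W id ?Z])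
    show "W \<subseteq> ?V" using WL by (auto simp: leaves_def)
    show "id x = id y" if "x \<in> W" "y \<in> W" "{x, y} \<in> uedges T" for x y
      using leaf_nbr_not_leaf[OF conn sg _ that(3) v'] that(1,2) WL by blast
    show "card ?V \<le> 4 * card (id ` W)" using bound by simp
    show "e \<inter> f = {}" if "e \<in> ?Z N" "f \<in> ?Z N" "e \<noteq> f" for N e f
      using that disj by auto
    show "\<exists>a\<in>uedges T. \<exists>b\<in>uedges T. a \<noteq> b \<and> f ` a \<in> ?Z N \<and> f ` b \<in> ?Z N"
      if f: "embedding T (blowup T W N) f" for N f
    proof -
      have "{v, a} \<inter> ?L = {}" using v' J_nl(2)[OF a(1)] by simp
      from embedding_inner_edge[OF T WL f va this]
      obtain e1 where e1: "e1 \<in> uedges T" "f ` e1 = ?\<iota> ` {v, a}" by (rule bexE)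
      note surj = embedding_inner_surj[OF T WL f] and inj = embedding_inner_inj[OF T WL f]
        and inner = embedding_inner[OF T WL f]
      have "w \<in> (fst \<circ> f) ` I" unfolding I_def surj using J_nl[OF w(1)] by simp
      then obtain x where x: "x \<in> I" "fst (f x) = w" by auto
      have fst_edge: "{fst (f x), fst (f y)} \<in> uedges T" if "{x, y} \<in> uedges T" for x y
        using embedding_blowup_edge(1)[OF f that] .
      \<comment> \<open>If the center went to \<open>w\<close>, all of \<open>J\<close> would go to
        the only non-leaf neighbor of \<open>w\<close>, which is \<open>v\<close>; but
        \<open>J\<close> contains both \<open>a\<close> and \<open>w\<close>.\<close>
      have "x \<noteq> v"
      proof
        assume "x = v"
        have "fst (f y) = v" if "y \<in> J" for y
        proof -
          have "v \<in> nbrs T y" using nbJ[OF that] by simp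
          then have "{v, y} \<in> uedges T" by (simp add: nbrs_def insert_commute)
          then have "{w, fst (f y)} \<in> uedges T" using fst_edge[of v y] x \<open>x = v\<close> by simp
          moreover have "fst (f y) \<notin> ?L" using inner(1)[OF J_nl[OF that]] by blast
          ultimately show ?thesis using nbJ[OF w(1)] by (auto simp: nbrs_def B_def)
        qed
        then have "(fst \<circ> f) a = (fst \<circ> f) w" using a w by simp
        then show False using inj_onD[OF inj] a J_nl[OF a(1)] J_nl[OF w(1)] by blast
      qed
      then have xJ: "x \<in> J" using x by (simp add: J_def)
      \<comment> \<open>No neighbor of \<open>w\<close> is blown up, so \<open>f\<close> maps the
        neighbors of \<open>x\<close> injectively into those of \<open>w\<close> at index 0.
        Minimality of \<open>p w\<close> forces equality, so every edge at \<open>w\<close> is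
        used.\<close>
      have "f ` nbrs T x = ?\<iota> ` nbrs T w"
      proof (rule card_subset_eq)
        show "finite (?\<iota> ` nbrs T w)" using finite_nbrs[OF sg] by blast
        have "f y \<in> ?\<iota> ` nbrs T w" if y: "y \<in> nbrs T x" for y
        proof -
          have e: "{x, y} \<in> uedges T" using y by (simp add: nbrs_def)
          then have y': "fst (f y) \<in> nbrs T w" using fst_edge[OF e] x by (simp add: nbrs_def)
          then have "fst (f y) \<notin> W"
            using nbJ[OF w(1)] v' by (auto simp: W_def)
          moreover have "snd (f y) \<in> slots W N (fst (f y))"
            using embedding_blowup_edge(2)[OF f, of y x] e by (simp add: insert_commute)
          ultimately have "f y = ?\<iota> (fst (f y))" by (simp add: slots_def prod_eq_iff)
          then show ?thesis using y' by (rule image_eqI)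
        qed
        then show sub: "f ` nbrs T x \<subseteq> ?\<iota> ` nbrs T w" by blast
        have "inj_on f (nbrs T x)"
          by (rule inj_on_subset[OF _ nbrs_subset[OF sg]]) (use f in \<open>simp add: embedding_def\<close>)
        then have "card (f ` nbrs T x) = Suc (p x)" using cardn[OF xJ] by (simp add: card_image)
        moreover have "card (?\<iota> ` nbrs T w) = Suc (p w)"
          using cardn[OF w(1)] by (simp add: card_image inj_on_def)
        ultimately show "card (f ` nbrs T x) = card (?\<iota> ` nbrs T w)"
          using w(2)[OF xJ] card_mono[OF finite_imageI[OF finite_nbrs[OF sg]] sub] by simp
      qed
      moreover have "l \<in> nbrs T w" using lw by (simp add: nbrs_def)
      ultimately have "?\<iota> l \<in> f ` nbrs T x" by blast
      then obtain y where y: "y \<in> nbrs T x" "f y = (l, 0)" by auto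
      have "f x = (w, 0)" using x(2) inner(2)[OF J_nl[OF xJ]] by (simp add: prod_eq_iff)
      then have e2: "{x, y} \<in> uedges T" "f ` {x, y} = ?\<iota> ` {w, l}"
        using y by (simp_all add: nbrs_def)
      have ne: "e1 \<noteq> {x, y}"
      proof
        assume "e1 = {x, y}"
        then have "?\<iota> ` {v, a} = ?\<iota> ` {w, l}" using e1(2) e2(2) by simp
        then have "fst ` ?\<iota> ` {v, a} = fst ` ?\<iota> ` {w, l}" by simp
        then have "{v, a} = {w, l}" unfolding image_image by simp
        then show False using disj by simp
      qed
      have "f ` e1 \<in> ?Z N" "f ` {x, y} \<in> ?Z N" unfolding e1(2) e2(2) by simp_all
      then show ?thesis using ne e1(1) e2(1) by (intro bexI[of _ e1] bexI[of _ "{x, y}"] conjI)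
    qed
  qed
qed

section \<open>Choice among the three constructions\<close>

theorem theorem1p3:
  fixes T :: "'a ugraph" and t :: nat
  assumes "is_tree T"
    and "card (uverts T) = t"
    and "\<not> is_star T"
    and "\<not> is_double_star T"
  shows "(\<lambda>n. real (rainbow_ex n T T)) \<in> \<Omega>(\<lambda>n. real n ^ nat \<lceil>real t / 4\<rceil>)"
proof -
  let ?V = "uverts T" and ?L = "leaves T"
  \<comment> \<open>The path supplies the non-leaves \<open>x2\<close>, \<open>v\<close>,
    \<open>x4\<close>; in the last case its middle \<open>v\<close> is the center of the
    star.\<close>
  obtain x1 x2 v x4 x5 where P: "graph_path T [x1, x2, v, x4, x5]"
    using path5_exists[OF assms(1,3,4)] by metis
  have sg: "simple_graph T" and conn: "connected_graph T" and acyc: "\<nexists>p. graph_cycle T p"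
    using assms(1) by (auto simp: is_tree_def)
  have finV: "finite ?V" using sg by (simp add: simple_graph_def)
  have dist: "distinct [x1, x2, v, x4, x5]" and sub: "set [x1, x2, v, x4, x5] \<subseteq> ?V"
    using P by (auto simp: graph_path_def)
  have "card (set [x1, x2, v, x4, x5]) = 5" using distinct_card[OF dist] by simp
  then have t5: "card ?V \<ge> 5" using card_mono[OF finV sub] by simp
  then have t2: "card ?V \<ge> 2" by simp
  have E: "{x1, x2} \<in> uedges T" "{x2, v} \<in> uedges T" "{v, x4} \<in> uedges T" "{x4, x5} \<in> uedges T"
    using P by (auto simp: graph_path_def adjacent_def)
  have inner: "y \<notin> ?L" if "{y, x} \<in> uedges T" "{y, z} \<in> uedges T" "x \<noteq> z" for x y z
    using leaf_nbrs[OF _ that(1)] leaf_nbrs[OF _ that(2)] that(3) by auto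
  have I: "x2 \<notin> ?L" "v \<notin> ?L" "x4 \<notin> ?L"
    using inner[of x2 x1 v] inner[of v x2 x4] inner[of x4 v x5] E dist by (simp_all add: insert_commute)
  show ?thesis
  proof (cases "card ?L + 1 + 2 * (card ?V div 3) \<le> card ?V")
    case True
    then show ?thesis using few_leaves[OF assms(1) t2] assms(2) by simp
  next
    \<comment> \<open>Now \<open>card ?L \<ge> card ?V - 2 * (card ?V div 3)\<close>, so at least a
      third of the vertices are leaves.\<close>
    case many: False
    show ?thesis
    proof (cases "\<exists>e\<in>uedges T. \<exists>f\<in>uedges T. e \<inter> ?L = {} \<and> f \<inter> ?L = {} \<and> e \<inter> f = {}")
      case True
      then obtain e f where ef: "e \<in> uedges T" "f \<in> uedges T" "e \<inter> ?L = {}" "f \<inter> ?L = {}" "e \<inter> f = {}"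
        by blast
      have "card ?V \<le> 4 * card ?L" using many by linarith
      from disjoint_inner_edges[OF assms(1) t2 this ef] show ?thesis using assms(2) by simp
    next
      case False
      \<comment> \<open>An edge between non-leaves that misses \<open>v\<close> must meet both
        \<open>{x2, v}\<close> and \<open>{v, x4}\<close>; it is then \<open>{x2, x4}\<close> and
        closes a triangle.\<close>
      have v_edge: "v \<in> e" if e: "e \<in> uedges T" "e \<inter> ?L = {}" for e
      proof (rule ccontr)
        assume "v \<notin> e"
        have "{x2, v} \<inter> ?L = {}" "{v, x4} \<inter> ?L = {}" using I by auto
        then have "e \<inter> {x2, v} \<noteq> {}" "e \<inter> {v, x4} \<noteq> {}" using False e E by blast+
        then have x24: "{x2, x4} \<subseteq> e" using \<open>v \<notin> e\<close> by auto
        obtain a b where "e = {a, b}" using simple_edge_cases[OF sg e(1)] by metis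
        then have "e = {x2, x4}" using x24 dist by auto
        then have "graph_cycle T [x2, v, x4]"
          using e E sub dist
          by (auto simp: graph_cycle_def graph_path_def adjacent_def insert_commute)
        then show False using acyc by blast
      qed
      \<comment> \<open>The second vertex \<open>y\<close> of a path from \<open>x\<close> to
        \<open>v\<close> is not a leaf, so the edge \<open>{x, y}\<close> contains \<open>v\<close>
        by \<open>v_edge\<close>, and \<open>y = v\<close>.\<close>
      have star: "nbrs T x \<inter> (?V - ?L) = {v}" if x: "x \<in> ?V - ?L - {v}" for x
      proof -
        have only: "y = v" if "y \<in> nbrs T x \<inter> (?V - ?L)" for y
        proof -
          have "{x, y} \<in> uedges T" "{x, y} \<inter> ?L = {}" using that x by (auto simp: nbrs_def)
          then show ?thesis using v_edge[of "{x, y}"] x by auto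
        qed
        obtain p where p: "graph_path T p" "hd p = x" "last p = v"
          using conn x sub by (auto simp: connected_graph_def)
        obtain y q where q: "p = x # y # q"
          using p x by (cases p; cases "tl p") (auto simp: graph_path_def)
        have xy: "{x, y} \<in> uedges T" "y \<in> ?V"
          using p q by (auto simp: graph_path_def adjacent_def)
        have "y = v"
        proof (cases q)
          case Nil
          then show ?thesis using p q by simp
        next
          case (Cons z r)
          then have "{y, x} \<in> uedges T" "{y, z} \<in> uedges T" "x \<noteq> z"
            using p q by (auto simp: graph_path_def adjacent_def insert_commute)
          then have "y \<notin> ?L" by (rule inner)
          then show ?thesis using only[of y] xy by (simp add: nbrs_def)
        qed
        then have "v \<in> nbrs T x \<inter> (?V - ?L)" using xy I by (simp add: nbrs_def)
        then show ?thesis using only by blast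
      qed
      have "card {x2, v, x4} \<le> card (?V - ?L)"
        using I sub finV by (intro card_mono) auto
      then have c3: "card (?V - ?L) \<ge> 3" using dist by simp
      \<comment> \<open>Five vertices with two leaves belong to the first case, with equality: 2 + 1
        + 2 = 5.\<close>
      have "\<not> (card ?V = 5 \<and> card ?L = 2)" using many by auto
      moreover have "v \<in> ?V - ?L" using I sub by simp
      ultimately show ?thesis using inner_star[OF assms(1) t2 _ star c3] assms(2) by simp
    qed
  qed
qed

end
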